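(* Over an algebraically closed field $\mathbb{F}$, $\mathrm{Newton}\text{-}\mathrm{VNP}\subseteq\mathrm{VNP}$.
   Context: $\mathrm{VP}$: families $\{f_n\}$ with $\mathsf{poly}(n)$ variables and degree computed by $\mathsf{poly}(n)$-size arithmetic circuits over $\mathbb{F}$. $\mathrm{VNP}$: families with $\mathsf{poly}(n)$ variables and degree such that $f_n(x)=\sum_{e\in\{0,1\}^{\mathsf{poly}(n)}}g_n(x,e)$ for some $\{g_n\}\in\mathrm{VP}$. For $f=\sum_{\mathbf{e}}\alpha_{\mathbf{e}}\mathbf{x}^{\mathbf{e}}$, $\mathrm{NPT}(f)$ is the convex hull of the exponent vectors with nonzero coefficient; a face of a polytope $P$ is $P\cap\{v:\ell(v)=c\}$ with $\ell$ linear and $\ell\ge c$ on $P$; $f|_Q=\sum_{\mathbf{e}\in Q}\alpha_{\mathbf{e}}\mathbf{x}^{\mathbf{e}}$. $\{f_n\}\in\mathrm{Newton}\text{-}\mathrm{VNP}$ if there is $\{g_n\}\in\mathrm{VNP}$ such that each $f_n$ is $g_n|_Q$ for a face $Q$ of $\mathrm{NPT}(g_n)$, or a linear projection (substitution of affine linear combinations of new variables for the variables) of such a polynomial.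
   Formalization: Families in Newton-VNP are additionally required to have poly(n) variables; without this the inclusion fails, since the sum of 2^n new variables is a linear projection of a single variable but is not in VNP. *)

theory Defs
  imports
    "HOL-Analysis.Analysis"
    "HOL-Analysis.Finite_Function_Topology"
    "HOL-Computational_Algebra.Polynomial"
begin

section \<open>Multivariate polynomials\<close>

text \<open>
  An exponent vector is a finitely supported map from variable indices to exponents, and a
  polynomial is a finitely supported map from exponent vectors to coefficients. The ring
  structure (convolution product) is that of \<^theory>\<open>HOL-Library.Poly_Mapping\<close>.
\<close>

type_synonym 'a mpoly = "(nat \<Rightarrow>\<^sub>0 nat) \<Rightarrow>\<^sub>0 'a"

type_synonym 'a family = "nat \<Rightarrow> 'a mpoly"

definition Const :: "'a \<Rightarrow> 'a::zero mpoly" where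
  "Const a = Poly_Mapping.single 0 a"

definition Var :: "nat \<Rightarrow> 'a::zero_neq_one mpoly" where
  "Var i = Poly_Mapping.single (Poly_Mapping.single i 1) 1"

definition vars :: "'a::zero mpoly \<Rightarrow> nat set" where
  "vars f = (\<Union>m\<in>Poly_Mapping.keys f. Poly_Mapping.keys m)"

definition monom_degree :: "(nat \<Rightarrow>\<^sub>0 nat) \<Rightarrow> nat" where
  "monom_degree m = (\<Sum>i\<in>Poly_Mapping.keys m. Poly_Mapping.lookup m i)"

text \<open>The zero polynomial gets total degree 0.\<close>

definition total_degree :: "'a::zero mpoly \<Rightarrow> nat" where
  "total_degree f = Max (insert 0 (monom_degree ` Poly_Mapping.keys f))"

definition mpoly_subst :: "(nat \<Rightarrow> 'a::comm_ring_1 mpoly) \<Rightarrow> 'a mpoly \<Rightarrow> 'a mpoly" where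
  "mpoly_subst \<sigma> f =
     (\<Sum>m\<in>Poly_Mapping.keys f.
        Const (Poly_Mapping.lookup f m) *
        (\<Prod>i\<in>Poly_Mapping.keys m. \<sigma> i ^ Poly_Mapping.lookup m i))"

section \<open>Arithmetic circuits\<close>

text \<open>
  A circuit is a list of gates in topological order; \<open>Plus i j\<close> and \<open>Times i j\<close> refer to
  the gates at positions \<open>i\<close> and \<open>j\<close> of the list, which have to be earlier ones. Arbitrary
  field constants are allowed. The last gate is the output, and the size is the number of
  gates, inputs included (by fan-in two, this agrees with the number of edges up to a
  constant factor).
\<close>

datatype 'a gate = Input nat | Constant 'a | Plus nat nat | Times nat nat

type_synonym 'a circuit = "'a gate list"

primrec gate_wf :: "nat \<Rightarrow> 'a gate \<Rightarrow> bool" where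
  "gate_wf k (Input i) = True"
| "gate_wf k (Constant a) = True"
| "gate_wf k (Plus i j) = (i < k \<and> j < k)"
| "gate_wf k (Times i j) = (i < k \<and> j < k)"

primrec gate_value :: "'a::comm_ring_1 mpoly list \<Rightarrow> 'a gate \<Rightarrow> 'a mpoly" where
  "gate_value vs (Input i) = Var i"
| "gate_value vs (Constant a) = Const a"
| "gate_value vs (Plus i j) = vs ! i + vs ! j"
| "gate_value vs (Times i j) = vs ! i * vs ! j"

definition circuit_values :: "'a::comm_ring_1 circuit \<Rightarrow> 'a mpoly list" where
  "circuit_values C = fold (\<lambda>g vs. vs @ [gate_value vs g]) C []"

definition computes :: "'a::comm_ring_1 circuit \<Rightarrow> 'a mpoly \<Rightarrow> bool" where
  "computes C f \<longleftrightarrow>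
     C \<noteq> [] \<and> (\<forall>k<length C. gate_wf k (C ! k)) \<and> last (circuit_values C) = f"

section \<open>The classes VP and VNP\<close>

definition poly_bounded :: "(nat \<Rightarrow> nat) \<Rightarrow> bool" where
  "poly_bounded t \<longleftrightarrow> (\<exists>p :: nat poly. \<forall>n. t n \<le> poly p n)"

text \<open>The \<open>n\<close>-th member lies in \<open>F[x\<^sub>0, \<dots>, x\<^bsub>v(n) - 1\<^esub>]\<close> for a polynomially bounded \<open>v\<close>.\<close>

definition poly_many_vars :: "'a::zero family \<Rightarrow> bool" where
  "poly_many_vars f \<longleftrightarrow> (\<exists>v. poly_bounded v \<and> (\<forall>n. vars (f n) \<subseteq> {..<v n}))"

definition VP :: "'a::field family set" where
  "VP = {f. poly_many_vars f \<and> poly_bounded (\<lambda>n. total_degree (f n)) \<and>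
            (\<exists>s. poly_bounded s \<and> (\<forall>n. \<exists>C. computes C (f n) \<and> length C \<le> s n))}"

text \<open>
  For \<open>g \<in> F[x\<^sub>0, \<dots>, x\<^bsub>v - 1\<^esub>, y\<^sub>0, \<dots>, y\<^bsub>w - 1\<^esub>]\<close>, where \<open>y\<^sub>j\<close> is the variable with index
  \<open>v + j\<close>, this is the sum of \<open>g(x, e)\<close> over all \<open>e \<in> {0, 1}\<^sup>w\<close>.
\<close>

definition hypercube_sum :: "nat \<Rightarrow> nat \<Rightarrow> 'a::comm_ring_1 mpoly \<Rightarrow> 'a mpoly" where
  "hypercube_sum v w g =
     (\<Sum>e\<in>PiE {..<w} (\<lambda>_. {0, 1}).
        mpoly_subst (\<lambda>i. if i < v then Var i else Const (e (i - v))) g)"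

definition VNP :: "'a::field family set" where
  "VNP = {f. poly_many_vars f \<and> poly_bounded (\<lambda>n. total_degree (f n)) \<and>
             (\<exists>g\<in>VP. \<exists>v w. poly_bounded v \<and> poly_bounded w \<and>
                (\<forall>n. vars (f n) \<subseteq> {..<v n} \<and> vars (g n) \<subseteq> {..<v n + w n} \<and>
                     f n = hypercube_sum (v n) (w n) (g n)))}"

section \<open>Newton polytopes and Newton-VNP\<close>

text \<open>
  Newton polytopes live in the space \<open>nat \<Rightarrow>\<^sub>0 real\<close> of finitely supported real sequences,
  the union of all \<open>\<real>\<^sup>N\<close>. Every linear functional on \<open>\<real>\<^sup>N\<close> extends to this space, so
  the faces of a polytope in \<open>\<real>\<^sup>N\<close> are the same when computed in either space.
\<close>

definition exponent_point :: "(nat \<Rightarrow>\<^sub>0 nat) \<Rightarrow> (nat \<Rightarrow>\<^sub>0 real)" where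
  "exponent_point m = Poly_Mapping.map real m"

definition NPT :: "'a::zero mpoly \<Rightarrow> (nat \<Rightarrow>\<^sub>0 real) set" where
  "NPT f = convex hull (exponent_point ` Poly_Mapping.keys f)"

definition is_face :: "'v::real_vector set \<Rightarrow> 'v set \<Rightarrow> bool" where
  "is_face Q P \<longleftrightarrow>
     (\<exists>(l :: 'v \<Rightarrow> real) c. linear l \<and> (\<forall>v\<in>P. c \<le> l v) \<and> Q = P \<inter> {v. l v = c})"

definition mpoly_restrict :: "'a::comm_monoid_add mpoly \<Rightarrow> (nat \<Rightarrow>\<^sub>0 real) set \<Rightarrow> 'a mpoly" where
  "mpoly_restrict f Q =
     (\<Sum>m | m \<in> Poly_Mapping.keys f \<and> exponent_point m \<in> Q.
        Poly_Mapping.single m (Poly_Mapping.lookup f m))"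

definition affine_linear :: "'a::comm_ring_1 mpoly \<Rightarrow> bool" where
  "affine_linear p \<longleftrightarrow> (\<exists>N c a. p = Const c + (\<Sum>j<N. Const (a j) * Var j))"

definition linear_projection :: "'a::comm_ring_1 mpoly \<Rightarrow> 'a mpoly \<Rightarrow> bool" where
  "linear_projection f h \<longleftrightarrow> (\<exists>\<sigma>. (\<forall>i. affine_linear (\<sigma> i)) \<and> f = mpoly_subst \<sigma> h)"

text \<open>
  As for VP and VNP, the members of a family have polynomially many variables. This has to
  be required explicitly, since a linear projection of a single variable may involve any
  number of new variables. The degree needs no condition: neither restriction to a face nor
  linear projection increases it.
\<close>

definition Newton_VNP :: "'a::field family set" where
  "Newton_VNP = {f. poly_many_vars f \<and>
     (\<exists>g\<in>VNP. \<forall>n. \<exists>Q. is_face Q (NPT (g n)) \<and>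
        (f n = mpoly_restrict (g n) Q \<or> linear_projection (f n) (mpoly_restrict (g n) Q)))}"

end

theory Submission
  imports
    Defs
    "HOL-Analysis.Kronecker_Approximation_Theorem"
begin

text \<open>
  Dirichlet's simultaneous approximation replaces the real functional cutting out the face by an
  integral affine form \<open>W\<close> with the same zeros among the exponent vectors of \<open>g\<close>; its coefficients
  may be huge. Substituting \<open>x\<^sub>l \<mapsto> \<eta>\<^bsup>w\<^sub>l\<^esup> x\<^sub>l\<close> multiplies the monomial with exponent \<open>m\<close> by a power
  of \<open>\<eta>\<close> that differs from \<open>\<eta>\<^bsup>W(m)\<^esup>\<close> only by a constant factor. Let \<open>q\<close> be a prime other than
  the characteristic, and let \<open>\<eta>\<close> have order \<open>q\<^bsup>v+1\<^esup>\<close>. Then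
  \<open>\<eta>\<^bsup>W(m)\<^esup>\<close> is a nontrivial \<open>q\<close>-th root of unity \<open>\<beta>\<close> whenever \<open>W(m)\<close> has valuation \<open>v\<close>, so the factor
  \<open>(\<eta>\<^bsup>W(m)\<^esup> - \<beta>)/(1 - \<beta>)\<close> is 0 there and 1 on the face. The product over all occurring valuations
  selects the face. Only polynomially many valuations occur: subset sums of integers with distinct
  valuations are distinct, while the corresponding sums of exponent vectors lie in a small box.
  Each factor is a linear combination of the identity and a scaling of the variables, so
  expanding the product is a sum over a hypercube of rescaled copies of \<open>g\<close>. Field constants are free
  in circuits, so the size of \<open>W\<close> and the order of \<open>\<eta>\<close> are irrelevant.
\<close>

section \<open>Substitution, variables and degree\<close>

abbreviation monom_eval :: "(nat \<Rightarrow> 'b::comm_monoid_mult) \<Rightarrow> (nat \<Rightarrow>\<^sub>0 nat) \<Rightarrow> 'b" where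
  "monom_eval \<sigma> m \<equiv> \<Prod>i\<in>Poly_Mapping.keys m. \<sigma> i ^ Poly_Mapping.lookup m i"

lemma monom_eval_superset:
  assumes "finite S" "Poly_Mapping.keys m \<subseteq> S"
  shows "monom_eval \<sigma> m = (\<Prod>i\<in>S. \<sigma> i ^ Poly_Mapping.lookup m i)"
  using assms by (intro prod.mono_neutral_left) (auto simp: in_keys_iff)

lemma monom_eval_add: "monom_eval \<sigma> (m + m') = monom_eval \<sigma> m * monom_eval \<sigma> m'"
proof -
  let ?S = "Poly_Mapping.keys m \<union> Poly_Mapping.keys m'"
  have "monom_eval \<sigma> (m + m') = (\<Prod>i\<in>?S. \<sigma> i ^ Poly_Mapping.lookup (m + m') i)"
    using keys_add[of m m'] by (intro monom_eval_superset) auto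
  also have "\<dots> = (\<Prod>i\<in>?S. \<sigma> i ^ Poly_Mapping.lookup m i) * (\<Prod>i\<in>?S. \<sigma> i ^ Poly_Mapping.lookup m' i)"
    by (simp add: lookup_add power_add prod.distrib)
  also have "\<dots> = monom_eval \<sigma> m * monom_eval \<sigma> m'"
    by (subst (1 2) monom_eval_superset[of ?S]) auto
  finally show ?thesis .
qed

lemma monom_eval_mult: "monom_eval (\<lambda>i. \<sigma> i * \<tau> i) m = monom_eval \<sigma> m * monom_eval \<tau> m"
  by (simp add: power_mult_distrib prod.distrib)

lemma Const_0 [simp]: "Const 0 = 0"
  and Const_1 [simp]: "Const 1 = (1 :: 'a::comm_ring_1 mpoly)"
  and Const_add: "Const (a + b) = Const a + (Const b :: 'a mpoly)"
  and Const_mult: "Const (a * b) = Const a * (Const b :: 'a mpoly)"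
  by (simp_all add: Const_def single_add mult_single)

lemma Const_sum: "Const (\<Sum>i\<in>A. g i) = (\<Sum>i\<in>A. Const (g i) :: 'a::comm_ring_1 mpoly)"
  by (induction A rule: infinite_finite_induct) (simp_all add: Const_add)

lemma Const_prod: "Const (\<Prod>i\<in>A. g i) = (\<Prod>i\<in>A. Const (g i) :: 'a::comm_ring_1 mpoly)"
  by (induction A rule: infinite_finite_induct) (simp_all add: Const_mult)

lemma Const_power: "Const (a ^ n) = (Const a ^ n :: 'a::comm_ring_1 mpoly)"
  by (induction n) (simp_all add: Const_mult)

lemma mpoly_eq_sum_single:
  "f = (\<Sum>m\<in>Poly_Mapping.keys f. Poly_Mapping.single m (Poly_Mapping.lookup f m))"
proof (rule poly_mapping_eqI)
  fix k
  have "(\<Sum>m\<in>Poly_Mapping.keys f. Poly_Mapping.lookup (Poly_Mapping.single m (Poly_Mapping.lookup f m)) k)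
      = (\<Sum>m\<in>Poly_Mapping.keys f. if m = k then Poly_Mapping.lookup f m else 0)"
    by (intro sum.cong) (auto simp: lookup_single when_def)
  also have "\<dots> = Poly_Mapping.lookup f k"
    by (simp add: in_keys_iff)
  finally show "Poly_Mapping.lookup f k = Poly_Mapping.lookup
      (\<Sum>m\<in>Poly_Mapping.keys f. Poly_Mapping.single m (Poly_Mapping.lookup f m)) k"
    by (simp add: lookup_sum)
qed

lemma mpoly_subst_superset:
  assumes "finite S" "Poly_Mapping.keys f \<subseteq> S"
  shows "mpoly_subst \<sigma> f = (\<Sum>m\<in>S. Const (Poly_Mapping.lookup f m) * monom_eval \<sigma> m)"
  unfolding mpoly_subst_def using assms
  by (intro sum.mono_neutral_left) (auto simp: in_keys_iff)

lemma mpoly_subst_0 [simp]: "mpoly_subst \<sigma> 0 = 0"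
  by (simp add: mpoly_subst_def)

lemma mpoly_subst_single:
  "mpoly_subst \<sigma> (Poly_Mapping.single m a) = Const a * monom_eval \<sigma> m"
  by (simp add: mpoly_subst_def)

lemma mpoly_subst_Const [simp]: "mpoly_subst \<sigma> (Const a) = Const a"
  by (simp add: Const_def[of a] mpoly_subst_single)

lemma mpoly_subst_1 [simp]: "mpoly_subst \<sigma> 1 = 1"
  using mpoly_subst_Const[of \<sigma> 1] by simp

lemma mpoly_subst_Var [simp]: "mpoly_subst \<sigma> (Var i) = \<sigma> i"
  by (simp add: Var_def mpoly_subst_single)

lemma mpoly_subst_add: "mpoly_subst \<sigma> (f + g) = mpoly_subst \<sigma> f + mpoly_subst \<sigma> g"
proof -
  let ?S = "Poly_Mapping.keys f \<union> Poly_Mapping.keys g"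
  have "mpoly_subst \<sigma> (f + g) = (\<Sum>m\<in>?S. Const (Poly_Mapping.lookup (f + g) m) * monom_eval \<sigma> m)"
    using keys_add[of f g] by (intro mpoly_subst_superset) auto
  also have "\<dots> = mpoly_subst \<sigma> f + mpoly_subst \<sigma> g"
    by (subst (1 2) mpoly_subst_superset[of ?S])
      (auto simp: lookup_add Const_add distrib_right sum.distrib)
  finally show ?thesis .
qed

lemma mpoly_subst_sum: "mpoly_subst \<sigma> (\<Sum>i\<in>A. g i) = (\<Sum>i\<in>A. mpoly_subst \<sigma> (g i))"
  by (induction A rule: infinite_finite_induct) (simp_all add: mpoly_subst_add)

text \<open>Expanding both factors into monomials turns the convolution product into a double sum,
  where additivity of the substitution and \<open>monom_eval_add\<close> apply term by term.\<close>

lemma mpoly_subst_mult: "mpoly_subst \<sigma> (f * g) = mpoly_subst \<sigma> f * mpoly_subst \<sigma> g"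
proof -
  let ?c = "Poly_Mapping.lookup f" and ?d = "Poly_Mapping.lookup g"
  have "f * g = (\<Sum>m\<in>Poly_Mapping.keys f. \<Sum>m'\<in>Poly_Mapping.keys g.
      Poly_Mapping.single (m + m') (?c m * ?d m'))"
    by (subst mpoly_eq_sum_single[of f], subst mpoly_eq_sum_single[of g])
      (simp add: sum_product mult_single)
  also have "mpoly_subst \<sigma> \<dots> = (\<Sum>m\<in>Poly_Mapping.keys f. \<Sum>m'\<in>Poly_Mapping.keys g.
      (Const (?c m) * monom_eval \<sigma> m) * (Const (?d m') * monom_eval \<sigma> m'))"
    by (simp add: mpoly_subst_sum mpoly_subst_single monom_eval_add Const_mult mult_ac)
  also have "\<dots> = mpoly_subst \<sigma> f * mpoly_subst \<sigma> g"
    by (simp add: mpoly_subst_def sum_product)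
  finally show ?thesis .
qed

lemma mpoly_subst_prod: "mpoly_subst \<sigma> (\<Prod>i\<in>A. g i) = (\<Prod>i\<in>A. mpoly_subst \<sigma> (g i))"
  by (induction A rule: infinite_finite_induct) (simp_all add: mpoly_subst_mult)

lemma mpoly_subst_power: "mpoly_subst \<sigma> (f ^ n) = mpoly_subst \<sigma> f ^ n"
  by (induction n) (simp_all add: mpoly_subst_mult)

lemma mpoly_subst_mpoly_subst:
  "mpoly_subst \<rho> (mpoly_subst \<tau> f) = mpoly_subst (\<lambda>i. mpoly_subst \<rho> (\<tau> i)) f"
  unfolding mpoly_subst_def[of \<tau> f] mpoly_subst_def[of "\<lambda>i. mpoly_subst \<rho> (\<tau> i)" f]
  by (simp add: mpoly_subst_sum mpoly_subst_mult mpoly_subst_prod mpoly_subst_power)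

lemma mpoly_subst_cong:
  assumes "\<And>i. i \<in> vars f \<Longrightarrow> \<sigma> i = \<tau> i"
  shows "mpoly_subst \<sigma> f = mpoly_subst \<tau> f"
proof -
  have "monom_eval \<sigma> m = monom_eval \<tau> m" if "m \<in> Poly_Mapping.keys f" for m
    using that assms by (intro prod.cong) (force simp: vars_def)+
  then show ?thesis
    by (simp add: mpoly_subst_def)
qed

lemma monom_eval_Var: "monom_eval Var m = (Poly_Mapping.single m 1 :: 'a::comm_ring_1 mpoly)"
proof -
  have pow: "Var i ^ n = (Poly_Mapping.single (Poly_Mapping.single i n) 1 :: 'a mpoly)" for i n
    by (induction n) (simp_all add: Var_def mult_single flip: single_add)
  have prod: "(\<Prod>i\<in>S. Poly_Mapping.single (h i) 1) = (Poly_Mapping.single (\<Sum>i\<in>S. h i) 1 :: 'a mpoly)"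
    for S and h :: "nat \<Rightarrow> (nat \<Rightarrow>\<^sub>0 nat)"
    by (induction S rule: infinite_finite_induct) (simp_all add: mult_single)
  show ?thesis
    by (simp add: pow prod flip: mpoly_eq_sum_single)
qed

lemma mpoly_subst_Var_id: "mpoly_subst Var f = f"
  unfolding mpoly_subst_def monom_eval_Var
  by (subst (3) mpoly_eq_sum_single) (simp add: Const_def mult_single)

section \<open>Variables of sums, products and substitutions\<close>

lemma vars_add: "vars (f + g) \<subseteq> vars f \<union> vars g"
  unfolding vars_def using keys_add[of f g] by auto

lemma vars_mult: "vars (f * g) \<subseteq> vars f \<union> vars (g :: 'a::comm_ring_1 mpoly)"
proof
  fix i assume "i \<in> vars (f * g)"
  then obtain m where m: "m \<in> Poly_Mapping.keys (f * g)" "i \<in> Poly_Mapping.keys m"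
    by (auto simp: vars_def)
  then obtain a b where "m = a + b" "a \<in> Poly_Mapping.keys f" "b \<in> Poly_Mapping.keys g"
    using keys_mult[of f g] by blast
  with m show "i \<in> vars f \<union> vars g"
    using keys_add[of a b] by (auto simp: vars_def)
qed

lemma vars_Const [simp]: "vars (Const a) = {}"
  by (auto simp: vars_def Const_def)

lemma vars_0 [simp]: "vars 0 = {}"
  by (simp add: vars_def)

lemma vars_1 [simp]: "vars (1 :: 'a::comm_ring_1 mpoly) = {}"
  by (simp add: vars_def)

lemma vars_Var [simp]: "vars (Var i :: 'a::comm_ring_1 mpoly) = {i}"
  by (simp add: vars_def Var_def)

lemma vars_sum_subset: "(\<And>i. i \<in> A \<Longrightarrow> vars (g i) \<subseteq> B) \<Longrightarrow> vars (\<Sum>i\<in>A. g i) \<subseteq> B"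
proof (induction A rule: infinite_finite_induct)
  case (insert x F)
  then show ?case using vars_add[of "g x" "sum g F"] by auto
qed simp_all

lemma vars_mult_subset:
  "vars f \<subseteq> B \<Longrightarrow> vars g \<subseteq> B \<Longrightarrow> vars (f * g :: 'a::comm_ring_1 mpoly) \<subseteq> B"
  using vars_mult[of f g] by auto

lemma vars_add_subset: "vars f \<subseteq> B \<Longrightarrow> vars g \<subseteq> B \<Longrightarrow> vars (f + g) \<subseteq> B"
  using vars_add[of f g] by auto

lemma vars_prod_subset:
  "(\<And>i. i \<in> A \<Longrightarrow> vars (g i :: 'a::comm_ring_1 mpoly) \<subseteq> B) \<Longrightarrow> vars (\<Prod>i\<in>A. g i) \<subseteq> B"
proof (induction A rule: infinite_finite_induct)
  case (insert x F)
  then show ?case by (simp add: vars_mult_subset)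
qed simp_all

lemma vars_power_subset: "vars (f :: 'a::comm_ring_1 mpoly) \<subseteq> B \<Longrightarrow> vars (f ^ n) \<subseteq> B"
  by (induction n) (simp_all add: vars_mult_subset)

lemma vars_mpoly_subst_subset:
  assumes "\<And>i. i \<in> vars f \<Longrightarrow> vars (\<sigma> i) \<subseteq> B"
  shows "vars (mpoly_subst \<sigma> f) \<subseteq> B"
  unfolding mpoly_subst_def
proof (intro vars_sum_subset vars_mult_subset vars_prod_subset vars_power_subset)
  fix m i assume "m \<in> Poly_Mapping.keys f" "i \<in> Poly_Mapping.keys m"
  then show "vars (\<sigma> i) \<subseteq> B" by (intro assms) (auto simp: vars_def)
qed simp

section \<open>Degree bounds\<close>

lemma total_degree_le_iff:
  "total_degree f \<le> D \<longleftrightarrow> (\<forall>m\<in>Poly_Mapping.keys f. monom_degree m \<le> D)"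
  by (auto simp: total_degree_def)

lemma monom_degree_superset:
  assumes "finite S" "Poly_Mapping.keys m \<subseteq> S"
  shows "monom_degree m = (\<Sum>i\<in>S. Poly_Mapping.lookup m i)"
  unfolding monom_degree_def using assms
  by (intro sum.mono_neutral_left) (auto simp: in_keys_iff)

lemma monom_degree_add: "monom_degree (m + m') = monom_degree m + monom_degree m'"
proof -
  let ?S = "Poly_Mapping.keys m \<union> Poly_Mapping.keys m'"
  show ?thesis
    using keys_add[of m m']
    by (simp add: monom_degree_superset[of ?S] lookup_add sum.distrib)
qed

lemma total_degree_mult:
  "total_degree f \<le> D \<Longrightarrow> total_degree g \<le> E \<Longrightarrow> total_degree (f * g :: 'a::comm_ring_1 mpoly) \<le> D + E"
  unfolding total_degree_le_iff
proof
  fix m assume *: "\<forall>m\<in>Poly_Mapping.keys f. monom_degree m \<le> D"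
    "\<forall>m\<in>Poly_Mapping.keys g. monom_degree m \<le> E" "m \<in> Poly_Mapping.keys (f * g)"
  then obtain a b where "m = a + b" "a \<in> Poly_Mapping.keys f" "b \<in> Poly_Mapping.keys g"
    using keys_mult[of f g] by blast
  with * show "monom_degree m \<le> D + E" by (auto simp: monom_degree_add intro: add_mono)
qed

lemma total_degree_add:
  "total_degree f \<le> D \<Longrightarrow> total_degree g \<le> D \<Longrightarrow> total_degree (f + g) \<le> D"
  unfolding total_degree_le_iff using keys_add[of f g] by auto

lemma total_degree_Const [simp]: "total_degree (Const a) = 0"
  by (simp add: total_degree_def Const_def monom_degree_def)

lemma total_degree_0 [simp]: "total_degree 0 = 0"
  by (simp add: total_degree_def)

lemma total_degree_1 [simp]: "total_degree (1 :: 'a::comm_ring_1 mpoly) = 0"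
  by (simp add: total_degree_def monom_degree_def)

lemma total_degree_Var [simp]: "total_degree (Var i :: 'a::comm_ring_1 mpoly) = 1"
  by (simp add: total_degree_def Var_def monom_degree_def)

lemma total_degree_sum:
  "(\<And>i. i \<in> A \<Longrightarrow> total_degree (g i) \<le> D) \<Longrightarrow> total_degree (\<Sum>i\<in>A. g i) \<le> D"
  by (induction A rule: infinite_finite_induct) (simp_all add: total_degree_add)

lemma total_degree_prod:
  "(\<And>i. i \<in> A \<Longrightarrow> total_degree (g i :: 'a::comm_ring_1 mpoly) \<le> D i) \<Longrightarrow>
    total_degree (\<Prod>i\<in>A. g i) \<le> (\<Sum>i\<in>A. D i)"
  by (induction A rule: infinite_finite_induct) (simp_all add: total_degree_mult)

lemma total_degree_power:
  "total_degree (f :: 'a::comm_ring_1 mpoly) \<le> D \<Longrightarrow> total_degree (f ^ n) \<le> n * D"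
  by (induction n) (simp_all add: total_degree_mult)

lemma total_degree_mpoly_subst:
  assumes "\<And>i. i \<in> vars f \<Longrightarrow> total_degree (\<sigma> i) \<le> D"
  shows "total_degree (mpoly_subst \<sigma> f) \<le> total_degree f * D"
  unfolding mpoly_subst_def
proof (intro total_degree_sum)
  fix m assume m: "m \<in> Poly_Mapping.keys f"
  have "total_degree (monom_eval \<sigma> m) \<le> (\<Sum>i\<in>Poly_Mapping.keys m. Poly_Mapping.lookup m i * D)"
    using m assms by (intro total_degree_prod total_degree_power) (auto simp: vars_def)
  also have "\<dots> = monom_degree m * D"
    by (simp add: monom_degree_def sum_distrib_right)
  also have "\<dots> \<le> total_degree f * D"
    using m total_degree_le_iff[of f "total_degree f"] by (intro mult_right_mono) auto
  finally show "total_degree (Const (Poly_Mapping.lookup f m) * monom_eval \<sigma> m) \<le> total_degree f * D"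
    using total_degree_mult[of "Const (Poly_Mapping.lookup f m)" 0] by force
qed

section \<open>Building circuits\<close>

lemma circuit_values_Nil [simp]: "circuit_values [] = []"
  by (simp add: circuit_values_def)

lemma circuit_values_snoc:
  "circuit_values (C @ [g]) = circuit_values C @ [gate_value (circuit_values C) g]"
  by (simp add: circuit_values_def)

lemma length_circuit_values [simp]: "length (circuit_values C) = length C"
  by (induction C rule: rev_induct) (simp_all add: circuit_values_snoc)

text \<open>The well-formedness clause of \<open>computes\<close> by itself, meaningful also for the
  empty circuit, from which constructions start.\<close>

definition circuit_wf :: "'a circuit \<Rightarrow> bool" where
  "circuit_wf C \<longleftrightarrow> (\<forall>k<length C. gate_wf k (C ! k))"

lemma circuit_wf_Nil [simp]: "circuit_wf []"
  by (simp add: circuit_wf_def)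

lemma circuit_wf_snoc: "circuit_wf (C @ [g]) \<longleftrightarrow> circuit_wf C \<and> gate_wf (length C) g"
  by (auto simp: circuit_wf_def nth_append less_Suc_eq)

lemma set_circuit_values_append:
  "set (circuit_values C) \<subseteq> set (circuit_values (C @ D))"
proof (induction D rule: rev_induct)
  case (snoc g D)
  then show ?case
    using circuit_values_snoc[of "C @ D" g] by auto
qed simp

section \<open>Gate counts relative to polynomials already computed\<close>

text \<open>Relative circuit complexity. Extending an arbitrary circuit that already contains
  \<open>A\<close> lets shared intermediate results be paid for once and makes costs add under
  composition.\<close>

definition derives :: "'a::comm_ring_1 mpoly set \<Rightarrow> nat \<Rightarrow> 'a mpoly set \<Rightarrow> bool" where
  "derives A s B \<longleftrightarrow> (\<forall>C. circuit_wf C \<longrightarrow> A \<subseteq> set (circuit_values C) \<longrightarrow>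
     (\<exists>D. circuit_wf (C @ D) \<and> length D \<le> s \<and> B \<subseteq> set (circuit_values (C @ D))))"

lemma derives_refl: "B \<subseteq> A \<Longrightarrow> derives A 0 B"
  unfolding derives_def by (metis append_Nil2 list.size(3) order.refl order.trans)

lemma derives_mono:
  "derives A s B \<Longrightarrow> A \<subseteq> A' \<Longrightarrow> s \<le> s' \<Longrightarrow> B' \<subseteq> B \<Longrightarrow> derives A' s' B'"
  unfolding derives_def by (meson order.trans)

text \<open>Appending gates discards no earlier value, so the second stage may use \<open>A\<close>
  and \<open>B\<close>, and \<open>B\<close> survives in the result.\<close>

lemma derives_trans:
  assumes "derives A s B" "derives (A \<union> B) t E"
  shows "derives A (s + t) (B \<union> E)"
  unfolding derives_def
proof (intro allI impI)
  fix C :: "'a circuit" assume C: "circuit_wf C" "A \<subseteq> set (circuit_values C)"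
  then obtain D where D: "circuit_wf (C @ D)" "length D \<le> s" "B \<subseteq> set (circuit_values (C @ D))"
    using assms(1) unfolding derives_def by blast
  have "A \<union> B \<subseteq> set (circuit_values (C @ D))"
    using C D set_circuit_values_append[of C D] by auto
  with D obtain D' where D': "circuit_wf ((C @ D) @ D')" "length D' \<le> t"
    "E \<subseteq> set (circuit_values ((C @ D) @ D'))"
    using assms(2) unfolding derives_def by blast
  have "B \<subseteq> set (circuit_values ((C @ D) @ D'))"
    using D set_circuit_values_append[of "C @ D" D'] by auto
  with D D' show "\<exists>D. circuit_wf (C @ D) \<and> length D \<le> s + t \<and> B \<union> E \<subseteq> set (circuit_values (C @ D))"
    by (intro exI[of _ "D @ D'"]) auto
qed

lemma derives_trans':
  assumes "derives A s B" "derives B t E"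
  shows "derives A (s + t) E"
proof (rule derives_mono[OF derives_trans[OF assms(1)]])
  show "derives (A \<union> B) t E" by (rule derives_mono[OF assms(2)]) auto
qed auto

lemma derives_Un:
  assumes "derives A s B" "derives A t E"
  shows "derives A (s + t) (B \<union> E)"
  by (rule derives_trans[OF assms(1) derives_mono[OF assms(2)]]) auto

lemma derives_gate:
  assumes "\<And>C. circuit_wf C \<Longrightarrow> A \<subseteq> set (circuit_values C) \<Longrightarrow>
    \<exists>g. gate_wf (length C) g \<and> gate_value (circuit_values C) g = p"
  shows "derives A 1 {p}"
  unfolding derives_def
proof (intro allI impI)
  fix C :: "'a circuit" assume C: "circuit_wf C" "A \<subseteq> set (circuit_values C)"
  then obtain g where "gate_wf (length C) g" "gate_value (circuit_values C) g = p"
    using assms by blast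
  with C show "\<exists>D. circuit_wf (C @ D) \<and> length D \<le> 1 \<and> {p} \<subseteq> set (circuit_values (C @ D))"
    by (intro exI[of _ "[g]"]) (simp add: circuit_wf_snoc circuit_values_snoc)
qed

lemma derives_Var: "derives A 1 {Var i}"
  by (rule derives_gate) (rule exI[of _ "Input i"], simp)

lemma derives_Const: "derives A 1 {Const a}"
  by (rule derives_gate) (rule exI[of _ "Constant a"], simp)

lemma derives_Plus: "derives {p, q} 1 {p + q}"
proof (rule derives_gate)
  fix C assume "{p, q} \<subseteq> set (circuit_values C)"
  then obtain i j where "i < length C" "j < length C"
    "circuit_values C ! i = p" "circuit_values C ! j = q" by (auto simp: in_set_conv_nth)
  then show "\<exists>g. gate_wf (length C) g \<and> gate_value (circuit_values C) g = p + q"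
    by (intro exI[of _ "Plus i j"]) simp
qed

lemma derives_Times: "derives {p, q} 1 {p * q}"
proof (rule derives_gate)
  fix C assume "{p, q} \<subseteq> set (circuit_values C)"
  then obtain i j where "i < length C" "j < length C"
    "circuit_values C ! i = p" "circuit_values C ! j = q" by (auto simp: in_set_conv_nth)
  then show "\<exists>g. gate_wf (length C) g \<and> gate_value (circuit_values C) g = p * q"
    by (intro exI[of _ "Times i j"]) simp
qed

lemma derives_add:
  assumes "derives A s {p}" "derives A t {q}"
  shows "derives A (s + t + 1) {p + q}"
proof -
  have "derives A (s + t) {p, q}" using derives_Un[OF assms] by (simp add: insert_commute)
  from derives_trans'[OF this derives_Plus] show ?thesis .
qed

lemma derives_mult:
  assumes "derives A s {p}" "derives A t {q}"
  shows "derives A (s + t + 1) {p * q}"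
proof -
  have "derives A (s + t) {p, q}" using derives_Un[OF assms] by (simp add: insert_commute)
  from derives_trans'[OF this derives_Times] show ?thesis .
qed

lemma derives_sum:
  assumes "\<And>i. i < N \<Longrightarrow> derives A s {p i}"
  shows "derives A (N * (s + 1) + 1) {\<Sum>i<N. p i}"
  using assms
proof (induction N)
  case 0
  then show ?case using derives_Const[of A 0] by simp
next
  case (Suc N)
  have "derives A (N * (s + 1) + 1 + s + 1) {(\<Sum>i<N. p i) + p N}"
    using Suc by (intro derives_add) auto
  then show ?case by (simp add: algebra_simps)
qed

lemma derives_prod:
  assumes "\<And>i. i < N \<Longrightarrow> derives A s {p i}"
  shows "derives A (N * (s + 1) + 1) {\<Prod>i<N. p i}"
  using assms
proof (induction N)
  case 0
  then show ?case using derives_Const[of A 1] by simp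
next
  case (Suc N)
  have "derives A (N * (s + 1) + 1 + s + 1) {(\<Prod>i<N. p i) * p N}"
    using Suc by (intro derives_mult) auto
  then show ?case by (simp add: algebra_simps)
qed

lemma derives_image:
  assumes "\<And>i. i < N \<Longrightarrow> derives A s {p i}"
  shows "derives A (N * s) (p ` {..<N})"
  using assms
proof (induction N)
  case 0
  then show ?case using derives_refl[of "{}"] by simp
next
  case (Suc N)
  have "derives A (N * s + s) (p ` {..<N} \<union> {p N})"
    using Suc by (intro derives_Un) auto
  then show ?case by (simp add: lessThan_Suc algebra_simps)
qed

text \<open>The circuit is replayed gate by gate. Substitution is a ring homomorphism, so the image
  of each gate costs at most one gate; an input gate \<open>i\<close> becomes
  \<open>\<tau> i\<close>, which is at hand in \<open>A\<close>.\<close>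

lemma derives_mpoly_subst_values:
  assumes "circuit_wf C" "\<And>i. \<tau> i \<in> A"
  shows "derives A (length C) (mpoly_subst \<tau> ` set (circuit_values C))"
  using assms(1)
proof (induction C rule: rev_induct)
  case Nil
  then show ?case using derives_refl[of "{}"] by simp
next
  case (snoc g C)
  let ?v = "circuit_values C"
  let ?B = "mpoly_subst \<tau> ` set ?v"
  have IH: "derives A (length C) ?B" and g: "gate_wf (length C) g"
    using snoc by (auto simp: circuit_wf_snoc)
  have "derives (A \<union> ?B) 1 {mpoly_subst \<tau> (gate_value ?v g)}"
  proof (cases g)
    case (Input i)
    then show ?thesis
      using assms(2)[of i] by (intro derives_mono[OF derives_refl[of "{\<tau> i}" A]]) auto
  next
    case (Constant a)
    then show ?thesis using derives_Const by simp
  next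
    case (Plus i j)
    then show ?thesis
      using g by (intro derives_mono[OF derives_Plus]) (auto simp: mpoly_subst_add)
  next
    case (Times i j)
    then show ?thesis
      using g by (intro derives_mono[OF derives_Times]) (auto simp: mpoly_subst_mult)
  qed
  from derives_trans[OF IH this] show ?case
    by (simp add: circuit_values_snoc)
qed

lemma derives_mpoly_subst:
  assumes "computes C f" "\<And>i. \<tau> i \<in> A"
  shows "derives A (length C) {mpoly_subst \<tau> f}"
proof (rule derives_mono[OF derives_mpoly_subst_values[where A=A and \<tau>=\<tau>]])
  show "circuit_wf C" using assms by (simp add: computes_def circuit_wf_def)
  have "circuit_values C \<noteq> []" using assms
    by (metis computes_def length_0_conv length_circuit_values)
  then show "{mpoly_subst \<tau> f} \<subseteq> mpoly_subst \<tau> ` set (circuit_values C)"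
    using assms by (auto simp: computes_def)
qed (use assms in auto)

lemma derives_computes:
  assumes "derives {} s {f}"
  shows "\<exists>C. computes C f \<and> length C \<le> s + 2"
proof -
  obtain C where C: "circuit_wf C" "length C \<le> s" "f \<in> set (circuit_values C)"
    using assms unfolding derives_def
    by (metis append_Nil circuit_wf_Nil empty_subsetI insert_subset)
  then obtain i where i: "i < length C" "circuit_values C ! i = f"
    by (auto simp: in_set_conv_nth)
  \<comment> \<open>\<open>computes\<close> reads the last gate, whereas \<open>f\<close> may sit
    anywhere; it is copied to the end as \<open>f + 0\<close>. Position \<open>length C\<close>
    holds the constant 0. Hence the two extra gates.\<close>
  let ?C = "(C @ [Constant 0]) @ [Plus i (length C)]"
  have "circuit_wf ?C" using C i by (simp only: circuit_wf_snoc) simp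
  moreover have "circuit_values ?C = circuit_values C @ [0, f]"
    using i by (simp only: circuit_values_snoc) (simp add: nth_append)
  ultimately have "computes ?C f"
    by (simp add: computes_def circuit_wf_def)
  with C show ?thesis by (intro exI[of _ ?C]) simp
qed

section \<open>Separating a face by roots of unity\<close>

text \<open>A sufficiently good simultaneous approximation preserves vanishing on a finite set:
  where the real form is 0, the integer form has absolute value below 1; where it is nonzero, its
  multiple by the common denominator exceeds the approximation error.\<close>

lemma integer_weights:
  fixes l :: "nat \<Rightarrow> real" and c :: real
  assumes "finite M"
  obtains w :: "nat \<Rightarrow> int" and d :: int
  where "\<And>m :: nat \<Rightarrow> nat. m \<in> M \<Longrightarrow>
    (\<Sum>i<N. w i * int (m i)) = d \<longleftrightarrow> (\<Sum>i<N. l i * real (m i)) = c"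
proof -
  define L where "L m = (\<Sum>i<N. l i * real (m i)) - c" for m :: "nat \<Rightarrow> nat"
  \<comment> \<open>The error of the form at \<open>m\<close> is at most \<open>S m\<close> times
    that of a single coefficient; the additional 1 is for the constant \<open>c\<close>.\<close>
  define S where "S m = real (\<Sum>i<N. m i) + 1" for m :: "nat \<Rightarrow> nat"
  have S1: "S m \<ge> 1" for m by (simp add: S_def sum_nonneg)
  \<comment> \<open>A denominator beyond the first summand makes the error less than 1, beyond the
    second less than \<open>\<bar>L m\<bar>\<close>. For \<open>L m = 0\<close> the quotient is 0 by
    convention.\<close>
  define K where "K m = S m + S m / \<bar>L m\<bar>" for m
  obtain R :: nat where R: "\<And>m. m \<in> M \<Longrightarrow> K m < real R"
  proof -
    obtain R where R: "Max (insert 0 (K ` M)) < real R" using reals_Archimedean2 by blast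
    have "K m < real R" if "m \<in> M" for m
      using Max_ge[of "insert 0 (K ` M)" "K m"] assms that R by simp
    then show ?thesis using that by blast
  qed
  define R' where "R' = Suc R"
  \<comment> \<open>The constant \<open>c\<close> is approximated along with the coefficients, at
    index \<open>N\<close>.\<close>
  define \<theta> where "\<theta> i = (if i < N then l i else c)" for i
  have "R' > 0" by (simp add: R'_def)
  then obtain q p where q: "0 < q" "q \<le> int (R' ^ Suc N)"
    and p: "\<And>i. i < Suc N \<Longrightarrow> \<bar>of_int q * \<theta> i - of_int (p i)\<bar> < 1 / real R'"
    by (rule Dirichlet_approx_simult[where n="Suc N" and \<theta>=\<theta>]) blast
  define W where "W m = (\<Sum>i<N. p i * int (m i)) - p N" for m :: "nat \<Rightarrow> nat"
  have close: "\<bar>of_int q * L m - of_int (W m)\<bar> \<le> S m / real R'" for m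
  proof -
    have "of_int q * L m - of_int (W m)
        = (\<Sum>i<N. (of_int q * \<theta> i - of_int (p i)) * real (m i)) - (of_int q * \<theta> N - of_int (p N))"
      by (simp add: L_def W_def \<theta>_def sum_distrib_left algebra_simps sum_subtractf)
    also have "\<bar>\<dots>\<bar> \<le> \<bar>\<Sum>i<N. (of_int q * \<theta> i - of_int (p i)) * real (m i)\<bar> + \<bar>of_int q * \<theta> N - of_int (p N)\<bar>"
      by (rule abs_triangle_ineq4)
    also have "\<dots> \<le> (\<Sum>i<N. \<bar>(of_int q * \<theta> i - of_int (p i)) * real (m i)\<bar>) + \<bar>of_int q * \<theta> N - of_int (p N)\<bar>"
      by (intro add_mono sum_abs) auto
    also have "\<dots> \<le> (\<Sum>i<N. (1 / real R') * real (m i)) + 1 / real R'"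
      unfolding abs_mult using p by (intro add_mono sum_mono mult_mono) (auto intro: less_imp_le)
    also have "\<dots> = S m / real R'"
      unfolding S_def sum_distrib_left[symmetric] by (simp add: add_divide_distrib)
    finally show ?thesis .
  qed
  have "W m = 0 \<longleftrightarrow> L m = 0" if m: "m \<in> M" for m
  proof
    have *: "S m + S m / \<bar>L m\<bar> < real R'" using R[OF m] by (simp add: R'_def K_def)
    have "S m / \<bar>L m\<bar> \<ge> 0" using S1[of m] by simp
    with * have "S m < real R'" by linarith
    then have "S m / real R' < 1" using \<open>R' > 0\<close> by simp
    moreover assume "L m = 0"
    ultimately have "\<bar>real_of_int (W m)\<bar> < 1" using close[of m] by simp
    then show "W m = 0" by linarith
  next
    assume "W m = 0"
    show "L m = 0"
    proof (rule ccontr)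
      assume nz: "L m \<noteq> 0"
      have "S m / \<bar>L m\<bar> < real R'" using R[OF m] S1[of m] by (simp add: R'_def K_def)
      then have "S m / real R' < \<bar>L m\<bar>"
        using nz by (simp add: field_simps R'_def)
      also have "\<dots> \<le> of_int q * \<bar>L m\<bar>" using q mult_right_mono[of 1 "real_of_int q" "\<bar>L m\<bar>"] by simp
      finally show False using close[of m] \<open>W m = 0\<close> q by (simp add: abs_mult)
    qed
  qed
  then show ?thesis using that[of p "p N"] by (simp add: W_def L_def)
qed

section \<open>Counting the valuations that occur\<close>

text \<open>The difference of two such sums has the least valuation occurring in the symmetric difference
  of the two index sets.\<close>

lemma subset_sums_distinct_valuations:
  fixes W :: "nat \<Rightarrow> int" and q :: int
  assumes q: "prime q" and V: "finite V"
    and W: "\<And>v. v \<in> V \<Longrightarrow> W v \<noteq> 0 \<and> multiplicity q (W v) = v"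
  shows "inj_on (\<lambda>A. \<Sum>v\<in>A. W v) (Pow V)"
proof (rule inj_onI, rule ccontr)
  fix A B assume AB: "A \<in> Pow V" "B \<in> Pow V" and eq: "(\<Sum>v\<in>A. W v) = (\<Sum>v\<in>B. W v)" and ne: "A \<noteq> B"
  have fin: "finite A" "finite B" using AB V finite_subset by auto
  define D where "D = (A - B) \<union> (B - A)"
  have "finite D" "D \<noteq> {}" using fin ne by (auto simp: D_def)
  define v where "v = Min D"
  have v: "v \<in> D" "\<And>u. u \<in> D \<Longrightarrow> v \<le> u" using \<open>finite D\<close> \<open>D \<noteq> {}\<close> by (simp_all add: v_def)
  define s :: "nat \<Rightarrow> int" where "s u = (if u \<in> A then 1 else -1)" for u
  have dv: "q ^ Suc v dvd W u" if "u \<in> D - {v}" for u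
  proof -
    have "Suc v \<le> u" using v(2)[of u] that by force
    moreover have "multiplicity q (W u) = u" using W[of u] that AB by (auto simp: D_def)
    ultimately show ?thesis by (intro multiplicity_dvd') auto
  qed
  have "0 = (\<Sum>u\<in>A. W u) - (\<Sum>u\<in>B. W u)" using eq by simp
  also have "\<dots> = (\<Sum>u\<in>A-B. W u) - (\<Sum>u\<in>B-A. W u)"
    using fin by (simp add: sum_diff_distrib sum.Int_Diff[of A W B] sum.Int_Diff[of B W A] Int_commute)
  also have "\<dots> = (\<Sum>u\<in>D. s u * W u)"
    unfolding D_def using fin
    by (subst sum.union_disjoint) (auto simp: s_def sum_negf intro!: sum.cong)
  also have "\<dots> = s v * W v + (\<Sum>u\<in>D-{v}. s u * W u)"
    using v \<open>finite D\<close> by (simp add: sum.remove)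
  finally have "s v * W v = - (\<Sum>u\<in>D-{v}. s u * W u)" by simp
  moreover have "q ^ Suc v dvd (\<Sum>u\<in>D-{v}. s u * W u)" by (intro dvd_sum dvd_mult dv)
  ultimately have "q ^ Suc v dvd s v * W v" by (metis dvd_minus_iff)
  then have "q ^ Suc v dvd W v" by (auto simp: s_def split: if_splits)
  moreover have "W v \<noteq> 0" "multiplicity q (W v) = v" using W[of v] v AB by (auto simp: D_def)
  moreover have "\<not> is_unit q" using q by auto
  ultimately show False using power_dvd_iff_le_multiplicity[of "W v" q "Suc v"] by auto
qed

lemma pow_two_less: "6 \<le> (u::nat) \<Longrightarrow> (u + 1)\<^sup>2 < 2 ^ u"
proof (induction u rule: dec_induct)
  case (step n)
  have "6 * 6 \<le> n * n" using step.hyps by (intro mult_le_mono) auto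
  then have "(Suc n + 1)\<^sup>2 \<le> 2 * (n + 1)\<^sup>2" using step.hyps by (simp add: power2_eq_square algebra_simps)
  with step.IH show ?case by simp
qed simp

text \<open>Resolves an inequality with \<open>t\<close> on both sides. For
  \<open>u = t div K\<close>, a larger \<open>t\<close> would give \<open>K * D + 7 \<le> u\<close>,
  hence \<open>t * D + 1 \<le> (u + 1)\<^sup>2 < 2 ^ u\<close>; the \<open>K\<close>-th power of
  this contradicts the assumption, as \<open>u * K \<le> t\<close>.\<close>

lemma two_power_le_bound:
  fixes t D K :: nat
  assumes "2 ^ t \<le> (t * D + 1) ^ K"
  shows "t \<le> K * (K * D + 7)"
proof (rule ccontr)
  assume "\<not> ?thesis"
  then have t: "K * (K * D + 7) < t" by simp
  show False
  proof (cases "K = 0")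
    case True
    with assms t less_exp[of t] show False by simp
  next
    case False
    define u where "u = t div K"
    have "K * D + 7 \<le> u" using t False by (simp add: u_def less_eq_div_iff_mult_less_eq mult.commute)
    have tu: "t < K * (u + 1)" "u * K \<le> t" using False
      by (simp_all add: u_def dividend_less_times_div)
    have "t * D + 1 \<le> (u + 1) * (u + 1)"
    proof -
      have "t * D + 1 \<le> K * (u + 1) * D + 1" using tu by simp
      also have "\<dots> \<le> (u + 1) * (K * D + 1)" by (simp add: algebra_simps)
      also have "\<dots> \<le> (u + 1) * (u + 1)" using \<open>K * D + 7 \<le> u\<close> by (intro mult_left_mono) auto
      finally show ?thesis .
    qed
    also have "\<dots> < 2 ^ u" using pow_two_less[of u] \<open>K * D + 7 \<le> u\<close> by (simp add: power2_eq_square)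
    finally have "(t * D + 1) ^ K < (2 ^ u) ^ K" using False by (intro power_strict_mono) auto
    also have "\<dots> \<le> 2 ^ t" using tu by (simp flip: power_mult)
    finally show False using assms by simp
  qed
qed

text \<open>Choose one representative per valuation. Distinct sets of valuations have distinct sums
  of \<open>W\<close>, and such a sum depends only on the vector sum and the number of the
  representatives. So \<open>2 ^ t\<close> subsets inject into a box of dimension
  \<open>N + 1\<close> with side linear in \<open>t\<close>, whatever the size of \<open>w\<close>
  and \<open>d\<close>.\<close>

lemma card_valuations_bound:
  fixes w :: "nat \<Rightarrow> int" and q d :: int and M :: "(nat \<Rightarrow> nat) set"
  assumes q: "prime q" and M: "finite M" "\<And>m i. m \<in> M \<Longrightarrow> i < N \<Longrightarrow> m i \<le> D"
    and nz: "\<And>m. m \<in> M \<Longrightarrow> (\<Sum>i<N. w i * int (m i)) \<noteq> d"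
  shows "card ((\<lambda>m. multiplicity q ((\<Sum>i<N. w i * int (m i)) - d)) ` M)
    \<le> (N + 1) * ((N + 1) * (D + 1) + 7)"
proof -
  define W where "W m = (\<Sum>i<N. w i * int (m i)) - d" for m :: "nat \<Rightarrow> nat"
  define V where "V = (\<lambda>m. multiplicity q (W m)) ` M"
  define t where "t = card V"
  have fV: "finite V" using M by (simp add: V_def)
  have "\<forall>v\<in>V. \<exists>m. m \<in> M \<and> multiplicity q (W m) = v" by (auto simp: V_def)
  then obtain r where r: "\<And>v. v \<in> V \<Longrightarrow> r v \<in> M \<and> multiplicity q (W (r v)) = v" by metis
  \<comment> \<open>Coordinate \<open>N\<close> holds the cardinality, because every summand of the
    form \<open>W\<close> contributes one \<open>- d\<close>.\<close>
  define h where "h A = (\<lambda>i\<in>{..<N+1}. if i < N then (\<Sum>v\<in>A. r v i) else card A)" for A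
  have "inj_on (\<lambda>A. \<Sum>v\<in>A. W (r v)) (Pow V)"
    using r nz by (intro subset_sums_distinct_valuations[OF q fV]) (auto simp: W_def)
  moreover have "(\<Sum>v\<in>A. W (r v)) = (\<Sum>i<N. w i * int (h A i)) - d * int (h A N)" if "A \<in> Pow V" for A
  proof -
    have "(\<Sum>v\<in>A. W (r v)) = (\<Sum>v\<in>A. \<Sum>i<N. w i * int (r v i)) - d * int (card A)"
      by (simp add: W_def sum_subtractf)
    also have "(\<Sum>v\<in>A. \<Sum>i<N. w i * int (r v i)) = (\<Sum>i<N. \<Sum>v\<in>A. w i * int (r v i))"
      by (rule sum.swap)
    finally show ?thesis
      by (simp add: h_def sum_distrib_left)
  qed
  ultimately have inj: "inj_on h (Pow V)"
    unfolding inj_on_def by metis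
  \<comment> \<open>The factor \<open>D + 1\<close> instead of \<open>D\<close> leaves room for the
    cardinality coordinate when \<open>D = 0\<close>.\<close>
  have "h A \<in> PiE {..<N+1} (\<lambda>_. {..t * (D + 1)})" if A: "A \<in> Pow V" for A
  proof -
    have c: "card A \<le> t" using A fV by (simp add: t_def card_mono)
    have "(\<Sum>v\<in>A. r v i) \<le> t * (D + 1)" if "i < N" for i
    proof -
      have "(\<Sum>v\<in>A. r v i) \<le> (\<Sum>v\<in>A. D)" using A r M(2) that by (intro sum_mono) auto
      also have "\<dots> = card A * D" by simp
      also have "\<dots> \<le> t * (D + 1)" using c by (intro mult_le_mono) auto
      finally show ?thesis .
    qed
    moreover have "card A \<le> t * (D + 1)" using c by (simp add: trans_le_add1)
    ultimately show ?thesis by (auto simp: h_def PiE_iff)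
  qed
  then have "card (Pow V) \<le> card (PiE {..<N+1} (\<lambda>_. {..t * (D + 1)}))"
    by (intro card_inj_on_le[OF inj]) (auto intro: finite_PiE)
  then have "2 ^ t \<le> (t * (D + 1) + 1) ^ (N + 1)"
    using fV by (simp add: card_Pow t_def card_PiE)
  from two_power_le_bound[OF this] show ?thesis
    by (simp only: t_def V_def W_def)
qed

section \<open>Multipliers that vanish off a hyperplane\<close>

text \<open>In characteristic 2 there are no square roots of unity other than 1, and q = 3 is used instead.\<close>

lemma root_of_unity_two_values:
  obtains q :: int and \<zeta> \<beta>1 \<beta>2 :: "'a::alg_closed_field"
  where "prime q" "\<zeta> \<noteq> 0" "\<beta>1 \<noteq> 1" "\<beta>2 \<noteq> 1"
    "\<And>u. \<not> q dvd u \<Longrightarrow> \<zeta> powi u = \<beta>1 \<or> \<zeta> powi u = \<beta>2"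
proof (cases "(2::'a) = 0")
  case False
  then have "(-1::'a) \<noteq> 1" by (metis add.inverse_inverse add_eq_0_iff one_add_one)
  moreover have "(-1::'a) powi u = -1" if "\<not> 2 dvd u" for u :: int
    using that by (simp add: power_int_minus_left) 
  ultimately show ?thesis using that[of 2 "-1" "-1" "-1"] by simp
next
  case True
  \<comment> \<open>A root of \<open>1 + X + X\<^sup>2\<close> is a cube root of unity, and it
    differs from 1 because \<open>1 + 1 + 1 = 1\<close> in characteristic 2.\<close>
  have "degree ([:1, 1, 1:] :: 'a poly) > 0" by simp
  then obtain \<zeta> :: 'a where "poly [:1, 1, 1:] \<zeta> = 0" using alg_closed_imp_poly_has_root by blast
  then have z: "1 + \<zeta> + \<zeta>\<^sup>2 = 0" by (simp add: algebra_simps power2_eq_square)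
  have z3: "\<zeta> ^ 3 = 1" 
  proof -
    have "\<zeta> ^ 3 - 1 = (\<zeta> - 1) * (1 + \<zeta> + \<zeta>\<^sup>2)" by (simp add: algebra_simps power2_eq_square power3_eq_cube)
    with z show ?thesis by simp
  qed
  have z0: "\<zeta> \<noteq> 0" using z3 by (intro notI) simp
  have z1: "\<zeta> \<noteq> 1"
  proof
    assume "\<zeta> = 1"
    with z have "(1 + 1) + (1::'a) = 0" by simp
    with True show False unfolding one_add_one by simp
  qed
  have z2: "\<zeta>\<^sup>2 \<noteq> 1" 
  proof
    assume "\<zeta>\<^sup>2 = 1"
    with z3 have "\<zeta> = 1" by (simp add: power2_eq_square power3_eq_cube)
    with z1 show False by simp
  qed
  \<comment> \<open>The two nonzero residues modulo 3 are the source of the two values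
    \<open>\<beta>1\<close> and \<open>\<beta>2\<close>; for \<open>q = 2\<close> they
    coincide.\<close>
  have "\<zeta> powi u = \<zeta> \<or> \<zeta> powi u = \<zeta>\<^sup>2" if "\<not> 3 dvd u" for u :: int
  proof -
    have "\<zeta> powi u = \<zeta> powi (3 * (u div 3) + u mod 3)" by simp
    also have "\<dots> = (\<zeta> powi 3) powi (u div 3) * \<zeta> powi (u mod 3)"
      using z0 by (simp only: power_int_add power_int_mult simp_thms)
    also have "\<zeta> powi 3 = 1" using z3 by simp
    finally have "\<zeta> powi u = \<zeta> powi (u mod 3)" by simp
    moreover have "u mod 3 = 1 \<or> u mod 3 = 2" using that by presburger
    ultimately show ?thesis by auto
  qed
  then show ?thesis using that[of 3 \<zeta> \<zeta> "\<zeta>\<^sup>2"] z0 z1 z2 by simp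
qed

lemma prod_powi_power:
  "(x :: 'a::field) \<noteq> 0 \<Longrightarrow> (\<Prod>l\<in>A. (x powi w l) ^ m l) = x powi (\<Sum>l\<in>A. w l * int (m l))"
  by (induction A rule: infinite_finite_induct) (simp_all add: power_int_add power_int_mult)

text \<open>Each occurring valuation gets two factors, one for each possible root of unity, which
  explains the 2 in \<open>k\<close>. Since \<open>k\<close> depends on \<open>N\<close> and
  \<open>D\<close> only, it stays polynomial however large the weights are.\<close>

lemma hyperplane_multipliers:
  fixes w :: "nat \<Rightarrow> int" and d :: int and M :: "(nat \<Rightarrow> nat) set"
  assumes M: "finite M" "\<And>m i. m \<in> M \<Longrightarrow> i < N \<Longrightarrow> m i \<le> D"
  defines "k \<equiv> 2 * ((N + 1) * ((N + 1) * (D + 1) + 7))"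
  obtains a b :: "nat \<Rightarrow> 'a::alg_closed_field" and \<theta> :: "nat \<Rightarrow> nat \<Rightarrow> 'a"
  where "\<And>m. m \<in> M \<Longrightarrow> (\<Prod>i<k. a i + b i * (\<Prod>l<N. \<theta> i l ^ m l))
    = (if (\<Sum>i<N. w i * int (m i)) = d then 1 else 0)"
proof -
  define W where "W m = (\<Sum>i<N. w i * int (m i)) - d" for m :: "nat \<Rightarrow> nat"
  obtain q :: int and \<zeta> \<beta>1 \<beta>2 :: 'a
    where q: "prime q" and \<zeta>: "\<zeta> \<noteq> 0" and \<beta>: "\<beta>1 \<noteq> 1" "\<beta>2 \<noteq> 1"
    and vals: "\<And>u. \<not> q dvd u \<Longrightarrow> \<zeta> powi u = \<beta>1 \<or> \<zeta> powi u = \<beta>2"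
    by (rule root_of_unity_two_values) blast
  have "q > 0" using q prime_gt_0_int by blast
  define V where "V = (\<lambda>m. multiplicity q (W m)) ` {m\<in>M. W m \<noteq> 0}"
  define t where "t = card V"
  have "t \<le> (N + 1) * ((N + 1) * (D + 1) + 7)"
    unfolding t_def V_def W_def using M by (intro card_valuations_bound q) auto
  then have tk: "2 * t \<le> k" by (simp add: k_def)
  have "finite V" using M by (simp add: V_def)
  then obtain e where e: "bij_betw e {0..<t} V"
    unfolding t_def using ex_bij_betw_nat_finite by blast
  \<comment> \<open>A \<open>q ^ v\<close>-th root of \<open>\<zeta>\<close>: its power with
    exponent \<open>q ^ v * u\<close> is \<open>\<zeta> powi u\<close>.\<close>
  have "\<exists>y. y ^ (nat q ^ v) = \<zeta>" for v
    using \<open>q > 0\<close> by (intro nth_root_exists) simp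
  then obtain \<eta> where \<eta>: "\<And>v. \<eta> v ^ (nat q ^ v) = \<zeta>" by metis
  have \<eta>0: "\<eta> v \<noteq> 0" for v
    using \<eta>[of v] \<zeta> \<open>q > 0\<close> by (auto simp: zero_power)
  define \<beta> where "\<beta> i = (if even i then \<beta>1 else \<beta>2)" for i :: nat
  have \<beta>1: "\<beta> i \<noteq> 1" for i using \<beta> by (simp add: \<beta>_def)
  \<comment> \<open>Factor \<open>i\<close> belongs to the valuation \<open>e (i div 2)\<close>, and
    its parity selects the root of unity. It is affine in the scaled monomial, with the shift by
    \<open>d\<close> absorbed into \<open>b\<close>. Indices from \<open>2 * t\<close> on are padded
    with the factor 1.\<close>
  define a where "a i = (if i < 2 * t then - \<beta> i / (1 - \<beta> i) else 1)" for i
  define b where "b i = (if i < 2 * t then \<eta> (e (i div 2)) powi (- d) / (1 - \<beta> i) else 0)" for i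
  define \<theta> where "\<theta> i l = \<eta> (e (i div 2)) powi w l" for i l
  have factor: "a i + b i * (\<Prod>l<N. \<theta> i l ^ m l)
      = (\<eta> (e (i div 2)) powi W m - \<beta> i) / (1 - \<beta> i)" if "i < 2 * t" for i m
  proof -
    have "\<eta> (e (i div 2)) powi (- d) * (\<Prod>l<N. \<theta> i l ^ m l) = \<eta> (e (i div 2)) powi W m"
      unfolding \<theta>_def W_def prod_powi_power[OF \<eta>0]
      by (subst power_int_add[symmetric]) (simp_all add: \<eta>0)
    with that show ?thesis
      by (simp add: a_def b_def diff_divide_distrib)
  qed
  have "(\<Prod>i<k. a i + b i * (\<Prod>l<N. \<theta> i l ^ m l)) = (if W m = 0 then 1 else 0)" if m: "m \<in> M" for m
  proof (cases "W m = 0")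
    case True
    have "a i + b i * (\<Prod>l<N. \<theta> i l ^ m l) = 1" for i
    proof (cases "i < 2 * t")
      case True
      with \<open>W m = 0\<close> \<beta>1[of i] show ?thesis by (simp add: factor)
    qed (simp add: a_def b_def)
    with True show ?thesis by simp
  next
    case False
    define v where "v = multiplicity q (W m)"
    have "v \<in> V" using False m by (auto simp: V_def v_def)
    then obtain j where j: "j < t" "e j = v" using e by (force simp: bij_betw_def)
    obtain u where u: "W m = q ^ v * u" "\<not> q dvd u"
      unfolding v_def using False q not_prime_unit multiplicity_decompose'[of "W m" q] by metis
    have "\<eta> v powi W m = (\<eta> v powi (q ^ v)) powi u"
      by (simp add: u power_int_mult)
    also have "\<eta> v powi (q ^ v) = \<eta> v powi int (nat q ^ v)" using \<open>q > 0\<close> by simp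
    also have "\<dots> = \<zeta>" by (simp only: power_int_of_nat \<eta>)
    finally have "\<eta> v powi W m = \<zeta> powi u" .
    then consider "\<eta> v powi W m = \<beta> (2 * j)" | "\<eta> v powi W m = \<beta> (2 * j + 1)"
      using vals[OF u(2)] by (auto simp: \<beta>_def)
    then have "\<exists>i<2 * t. a i + b i * (\<Prod>l<N. \<theta> i l ^ m l) = 0"
    proof cases
      case 1
      then show ?thesis using j by (intro exI[of _ "2 * j"]) (simp add: factor)
    next
      case 2
      then show ?thesis using j by (intro exI[of _ "2 * j + 1"]) (simp add: factor)
    qed
    with False tk show ?thesis by (force intro: prod_zero)
  qed
  then show ?thesis using that[of a b \<theta>] by (simp add: W_def)
qed

section \<open>Polynomial bounds, affine substitutions and restriction to a face\<close>

lemma poly_bounded_const: "poly_bounded (\<lambda>_. c)"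
  unfolding poly_bounded_def by (rule exI[of _ "[:c:]"]) simp

lemma poly_bounded_add: "poly_bounded s \<Longrightarrow> poly_bounded t \<Longrightarrow> poly_bounded (\<lambda>n. s n + t n)"
  unfolding poly_bounded_def by (metis poly_add add_mono)

lemma poly_bounded_mult: "poly_bounded s \<Longrightarrow> poly_bounded t \<Longrightarrow> poly_bounded (\<lambda>n. s n * t n)"
  unfolding poly_bounded_def by (metis poly_mult mult_le_mono)

lemma poly_bounded_mono: "poly_bounded t \<Longrightarrow> (\<And>n. s n \<le> t n) \<Longrightarrow> poly_bounded s"
  unfolding poly_bounded_def by (meson order.trans)

lemmas poly_bounded_intros = poly_bounded_const poly_bounded_add poly_bounded_mult

lemma affine_linear_Var: "affine_linear (Var i :: 'a::comm_ring_1 mpoly)"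
  unfolding affine_linear_def
proof (intro exI)
  have "(\<Sum>j<Suc i. Const (if j = i then 1 else 0) * Var j) = (\<Sum>j<Suc i. if j = i then Var j else 0 :: 'a mpoly)"
    by (intro sum.cong) auto
  also have "\<dots> = Var i" by simp
  finally show "Var i = Const 0 + (\<Sum>j<Suc i. Const (if j = i then 1 else 0 :: 'a) * Var j)" by simp
qed

lemma total_degree_affine_linear: "affine_linear p \<Longrightarrow> total_degree p \<le> 1"
proof -
  have "total_degree (Const a * Var j :: 'a mpoly) \<le> 1" for a j
    using total_degree_mult[of "Const a" 0 "Var j :: 'a mpoly" 1] by simp
  then show "affine_linear p \<Longrightarrow> total_degree p \<le> 1"
    unfolding affine_linear_def by (auto intro!: total_degree_add total_degree_sum)
qed

text \<open>An affine form may mention arbitrarily many variables; setting those from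
  \<open>N\<close> on to 0 leaves \<open>N\<close> terms, which bounds its circuit size.\<close>

lemma affine_linear_truncate:
  assumes "affine_linear (p :: 'a::comm_ring_1 mpoly)"
  obtains c a where "mpoly_subst (\<lambda>j. if j < N then Var j else 0) p = Const c + (\<Sum>j<N. Const (a j) * Var j)"
proof -
  obtain M c a where p: "p = Const c + (\<Sum>j<M. Const (a j) * Var j)"
    using assms by (auto simp: affine_linear_def)
  have "(\<Sum>j<M. Const (a j) * (if j < N then Var j else 0)) = (\<Sum>j\<in>{..<M} \<inter> {..<N}. Const (a j) * Var j :: 'a mpoly)"
    by (intro sum.mono_neutral_cong_right) auto
  also have "\<dots> = (\<Sum>j<N. Const (if j < M then a j else 0) * Var j)"
    by (intro sum.mono_neutral_cong_left) auto
  finally show ?thesis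
    using that[of c "\<lambda>j. if j < M then a j else 0"]
    by (simp add: p mpoly_subst_add mpoly_subst_sum mpoly_subst_mult)
qed

lemma mpoly_restrict_keys: "Poly_Mapping.keys (mpoly_restrict g Q) \<subseteq> Poly_Mapping.keys g"
proof (rule subsetI, rule ccontr)
  fix m assume m: "m \<in> Poly_Mapping.keys (mpoly_restrict g Q)" "m \<notin> Poly_Mapping.keys g"
  then have "Poly_Mapping.lookup (mpoly_restrict g Q) m = 0"
    unfolding mpoly_restrict_def lookup_sum by (intro sum.neutral) (auto simp: lookup_single when_def)
  with m show False by (simp add: in_keys_iff)
qed

lemma total_degree_mpoly_restrict: "total_degree (mpoly_restrict g Q) \<le> total_degree g"
  using mpoly_restrict_keys[of g Q] total_degree_le_iff[of g "total_degree g"]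
  by (auto simp: total_degree_le_iff)

text \<open>With the face as a 0/1 coefficient in a sum over all monomials of \<open>g\<close>, the
  indicator can be replaced by a product of multipliers.\<close>

lemma mpoly_subst_mpoly_restrict:
  "mpoly_subst \<sigma> (mpoly_restrict g Q) = (\<Sum>m\<in>Poly_Mapping.keys g.
     Const (Poly_Mapping.lookup g m) * Const (if exponent_point m \<in> Q then 1 else 0) * monom_eval \<sigma> m)"
  unfolding mpoly_restrict_def mpoly_subst_sum mpoly_subst_single
  by (intro sum.mono_neutral_cong_left) auto

lemma lookup_le_total_degree:
  "m \<in> Poly_Mapping.keys f \<Longrightarrow> Poly_Mapping.lookup m i \<le> total_degree f"
proof -
  assume m: "m \<in> Poly_Mapping.keys f"
  have "Poly_Mapping.lookup m i \<le> monom_degree m"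
    unfolding monom_degree_def by (cases "i \<in> Poly_Mapping.keys m") (auto simp: in_keys_iff intro!: member_le_sum)
  with m show ?thesis using total_degree_le_iff[of f "total_degree f"] by force
qed

lemma linear_exponent_point:
  fixes l :: "(nat \<Rightarrow>\<^sub>0 real) \<Rightarrow> real"
  assumes "linear l" "Poly_Mapping.keys m \<subseteq> {..<N}"
  shows "l (exponent_point m) = (\<Sum>i<N. l (Poly_Mapping.single i 1) * real (Poly_Mapping.lookup m i))"
proof -
  have scale: "Poly_Mapping.lookup (r *\<^sub>R x) i = r * Poly_Mapping.lookup x i"
    for r i and x :: "nat \<Rightarrow>\<^sub>0 real"
    unfolding scaleR_poly_mapping_def
    by (subst lookup_Abs_poly_mapping) (auto intro: finite_subset[OF _ finite_lookup[of x]])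
  have "exponent_point m = (\<Sum>i<N. real (Poly_Mapping.lookup m i) *\<^sub>R Poly_Mapping.single i 1)"
  proof (rule poly_mapping_eqI)
    fix j
    have "Poly_Mapping.lookup (\<Sum>i<N. real (Poly_Mapping.lookup m i) *\<^sub>R Poly_Mapping.single i (1::real)) j
        = (\<Sum>i<N. if i = j then real (Poly_Mapping.lookup m i) else 0)"
      by (simp add: lookup_sum scale lookup_single when_def if_distrib cong: if_cong)
    also have "\<dots> = real (Poly_Mapping.lookup m j)"
      using assms(2) by (auto simp: in_keys_iff)
    finally show "Poly_Mapping.lookup (exponent_point m) j = Poly_Mapping.lookup
        (\<Sum>i<N. real (Poly_Mapping.lookup m i) *\<^sub>R Poly_Mapping.single i (1::real)) j"
      by (simp add: exponent_point_def map.rep_eq when_def)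
  qed
  then show ?thesis
    using assms(1) by (simp add: linear_sum linear_scale mult.commute)
qed

text \<open>All exponent points of \<open>g\<close> lie in its Newton polytope, so for them
  membership in \<open>Q\<close> is the single equation \<open>l = c\<close>, which the integer
  weights reproduce.\<close>

lemma face_multipliers:
  fixes g :: "'a::alg_closed_field mpoly"
  assumes Q: "is_face Q (NPT g)" and g: "vars g \<subseteq> {..<N}"
  defines "k \<equiv> 2 * ((N + 1) * ((N + 1) * (total_degree g + 1) + 7))"
  obtains a b :: "nat \<Rightarrow> 'a" and \<theta> :: "nat \<Rightarrow> nat \<Rightarrow> 'a"
  where "\<And>m. m \<in> Poly_Mapping.keys g \<Longrightarrow>
    (\<Prod>i<k. a i + b i * (\<Prod>l<N. \<theta> i l ^ Poly_Mapping.lookup m l)) = (if exponent_point m \<in> Q then 1 else 0)"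
proof -
  obtain l :: "(nat \<Rightarrow>\<^sub>0 real) \<Rightarrow> real" and c where l: "linear l" and Ql: "Q = NPT g \<inter> {x. l x = c}"
    using Q by (auto simp: is_face_def)
  let ?M = "Poly_Mapping.lookup ` Poly_Mapping.keys g"
  obtain w d where w: "\<And>m. m \<in> ?M \<Longrightarrow> (\<Sum>i<N. w i * int (m i)) = d \<longleftrightarrow>
      (\<Sum>i<N. l (Poly_Mapping.single i 1) * real (m i)) = c"
    using integer_weights[of ?M N "\<lambda>i. l (Poly_Mapping.single i 1)" c] by auto
  have fin: "finite ?M" and le: "\<And>m i. m \<in> ?M \<Longrightarrow> i < N \<Longrightarrow> m i \<le> total_degree g"
    by (auto intro: lookup_le_total_degree)
  obtain a b :: "nat \<Rightarrow> 'a" and \<theta> where ab: "\<And>m. m \<in> ?M \<Longrightarrow>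
      (\<Prod>i<k. a i + b i * (\<Prod>l<N. \<theta> i l ^ m l)) = (if (\<Sum>i<N. w i * int (m i)) = d then 1 else 0)"
    unfolding k_def by (rule hyperplane_multipliers[of ?M N "total_degree g" w d]) (use fin le in blast)+
  have "exponent_point m \<in> Q \<longleftrightarrow> (\<Sum>i<N. w i * int (Poly_Mapping.lookup m i)) = d"
    if m: "m \<in> Poly_Mapping.keys g" for m
  proof -
    have "Poly_Mapping.keys m \<subseteq> {..<N}" using m g by (auto simp: vars_def)
    moreover have "exponent_point m \<in> NPT g" using m by (simp add: NPT_def hull_inc)
    ultimately show ?thesis
      using m by (simp add: Ql w linear_exponent_point[OF l])
  qed
  then show ?thesis using that[of a b \<theta>] ab by simp
qed

section \<open>The hypercube sum\<close>

text \<open>Splits a vector into its first \<open>w\<close> and its last \<open>k\<close>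
  coordinates; the restrictions make both parts extensional, as \<open>PiE\<close> demands.\<close>

lemma sum_PiE_lessThan_add:
  fixes w k :: nat
  shows
  "(\<Sum>e\<in>PiE {..<w + k} (\<lambda>_. B). G (restrict e {..<w}) (\<lambda>i\<in>{..<k}. e (w + i))) =
   (\<Sum>e1\<in>PiE {..<w} (\<lambda>_. B). \<Sum>e2\<in>PiE {..<k} (\<lambda>_. B). G e1 e2)"
  unfolding sum.cartesian_product
proof (rule sum.reindex_bij_witness[where
    j = "\<lambda>e. (restrict e {..<w}, \<lambda>i\<in>{..<k}. e (w + i))" and
    i = "\<lambda>(e1, e2). \<lambda>i\<in>{..<w + k}. if i < w then e1 i else e2 (i - w)"])
qed (auto simp: PiE_iff extensional_def fun_eq_iff restrict_def)

text \<open>Distributivity, with \<open>e i\<close> saying which summand of factor \<open>i\<close>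
  is taken: 0 gives \<open>a i\<close> without scaling, 1 gives \<open>b i\<close> with scaling by
  \<open>\<theta> i\<close>. The choice is written by affine interpolation, so that
  \<open>e i\<close> can become a circuit variable.\<close>

lemma sum_hypercube_multipliers:
  fixes a b :: "nat \<Rightarrow> 'a::comm_ring_1" and m :: "nat \<Rightarrow> nat"
  shows "(\<Sum>e\<in>PiE {..<k} (\<lambda>_. {0, 1}). (\<Prod>i<k. a i + (b i - a i) * e i) *
      (\<Prod>l<N. (\<Prod>i<k. 1 + (\<theta> i l - 1) * e i) ^ m l)) =
    (\<Prod>i<k. a i + b i * (\<Prod>l<N. \<theta> i l ^ m l))"
proof -
  define F where "F i x = (a i + (b i - a i) * x) * (\<Prod>l<N. (1 + (\<theta> i l - 1) * x) ^ m l)" for i x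
  have "(\<Prod>l<N. (\<Prod>i<k. 1 + (\<theta> i l - 1) * e i) ^ m l)
      = (\<Prod>i<k. \<Prod>l<N. (1 + (\<theta> i l - 1) * e i) ^ m l)" for e
    unfolding prod_power_distrib by (rule prod.swap)
  then have "(\<Prod>i<k. a i + (b i - a i) * e i) * (\<Prod>l<N. (\<Prod>i<k. 1 + (\<theta> i l - 1) * e i) ^ m l)
      = (\<Prod>i<k. F i (e i))" for e
    by (simp add: F_def prod.distrib)
  then have "?thesis \<longleftrightarrow> (\<Sum>e\<in>PiE {..<k} (\<lambda>_. {0, 1}). \<Prod>i<k. F i (e i)) =
    (\<Prod>i<k. a i + b i * (\<Prod>l<N. \<theta> i l ^ m l))" by simp
  also have "(\<Sum>e\<in>PiE {..<k} (\<lambda>_. {0, 1}). \<Prod>i<k. F i (e i)) = (\<Prod>i<k. \<Sum>x\<in>{0, 1}. F i x)"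
    by (rule prod_sum_PiE[symmetric]) auto
  also have "\<dots> = (\<Prod>i<k. a i + b i * (\<Prod>l<N. \<theta> i l ^ m l))"
    by (simp add: F_def)
  finally show ?thesis by simp
qed

text \<open>Scaling the variables multiplies each monomial by a constant. After exchanging the sums,
  the total constant at a monomial is the product of multipliers, hence the indicator of the
  face.\<close>

lemma mpoly_subst_restrict_eq_hypercube_sum:
  fixes g :: "'a::comm_ring_1 mpoly" and a b :: "nat \<Rightarrow> 'a"
  assumes g: "vars g \<subseteq> {..<N}"
    and mult: "\<And>m. m \<in> Poly_Mapping.keys g \<Longrightarrow>
      (\<Prod>i<k. a i + b i * (\<Prod>l<N. \<theta> i l ^ Poly_Mapping.lookup m l)) = (if exponent_point m \<in> Q then 1 else 0)"
  shows "mpoly_subst \<sigma> (mpoly_restrict g Q) =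
    (\<Sum>e\<in>PiE {..<k} (\<lambda>_. {0, 1}). Const (\<Prod>i<k. a i + (b i - a i) * e i) *
      mpoly_subst (\<lambda>l. Const (\<Prod>i<k. 1 + (\<theta> i l - 1) * e i) * \<sigma> l) g)"
proof -
  let ?E = "PiE {..<k} (\<lambda>_. {0, 1 :: 'a})"
  define \<alpha> where "\<alpha> e = (\<Prod>i<k. a i + (b i - a i) * e i)" for e
  define \<Theta> where "\<Theta> e l = (\<Prod>i<k. 1 + (\<theta> i l - 1) * e i)" for e l
  let ?c = "Poly_Mapping.lookup g"
  have "(\<Sum>e\<in>?E. Const (\<alpha> e) * mpoly_subst (\<lambda>l. Const (\<Theta> e l) * \<sigma> l) g)
      = (\<Sum>e\<in>?E. \<Sum>m\<in>Poly_Mapping.keys g.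
          Const (?c m) * Const (\<alpha> e * (\<Prod>l<N. \<Theta> e l ^ Poly_Mapping.lookup m l)) * monom_eval \<sigma> m)"
  proof (rule sum.cong[OF refl])
    fix e
    have "monom_eval (\<lambda>l. Const (\<Theta> e l) * \<sigma> l) m =
        Const (\<Prod>l<N. \<Theta> e l ^ Poly_Mapping.lookup m l) * monom_eval \<sigma> m"
      if m: "m \<in> Poly_Mapping.keys g" for m
    proof -
      have "Poly_Mapping.keys m \<subseteq> {..<N}" using m g by (auto simp: vars_def)
      then show ?thesis
        unfolding monom_eval_mult by (subst monom_eval_superset[of "{..<N}"]) (simp_all add: Const_prod Const_power)
    qed
    then show "Const (\<alpha> e) * mpoly_subst (\<lambda>l. Const (\<Theta> e l) * \<sigma> l) g = (\<Sum>m\<in>Poly_Mapping.keys g.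
          Const (?c m) * Const (\<alpha> e * (\<Prod>l<N. \<Theta> e l ^ Poly_Mapping.lookup m l)) * monom_eval \<sigma> m)"
      by (simp add: mpoly_subst_def sum_distrib_left Const_mult mult_ac)
  qed
  also have "\<dots> = (\<Sum>m\<in>Poly_Mapping.keys g. \<Sum>e\<in>?E.
          Const (?c m) * Const (\<alpha> e * (\<Prod>l<N. \<Theta> e l ^ Poly_Mapping.lookup m l)) * monom_eval \<sigma> m)"
    by (rule sum.swap)
  also have "\<dots> = (\<Sum>m\<in>Poly_Mapping.keys g.
      Const (?c m) * Const (if exponent_point m \<in> Q then 1 else 0) * monom_eval \<sigma> m)"
  proof (rule sum.cong[OF refl])
    fix m assume m: "m \<in> Poly_Mapping.keys g"
    have "(\<Sum>e\<in>?E. \<alpha> e * (\<Prod>l<N. \<Theta> e l ^ Poly_Mapping.lookup m l)) = (if exponent_point m \<in> Q then 1 else 0)"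
      unfolding \<alpha>_def \<Theta>_def by (rule trans[OF sum_hypercube_multipliers mult[OF m]])
    then show "(\<Sum>e\<in>?E. Const (?c m) * Const (\<alpha> e * (\<Prod>l<N. \<Theta> e l ^ Poly_Mapping.lookup m l)) * monom_eval \<sigma> m)
      = Const (?c m) * Const (if exponent_point m \<in> Q then 1 else 0) * monom_eval \<sigma> m"
      by (simp only: Const_sum[symmetric] sum_distrib_left[symmetric] sum_distrib_right[symmetric])
  qed
  also have "\<dots> = mpoly_subst \<sigma> (mpoly_restrict g Q)"
    by (rule mpoly_subst_mpoly_restrict[symmetric])
  finally show ?thesis by (simp only: \<alpha>_def \<Theta>_def)
qed

text \<open>In the witness, the variables \<open>v' + w + i\<close> for \<open>i < k\<close> range over the additional hypercube:
  on its point \<open>e\<close>, the variable \<open>l\<close> gets scaled by the product of those \<open>\<theta> i l\<close> with \<open>e i = 1\<close>.\<close>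

lemma hypercube_sum_witness:
  fixes g h f :: "'a::alg_closed_field mpoly"
  assumes g: "vars g \<subseteq> {..<v}" "g = hypercube_sum v w h"
    and h: "vars h \<subseteq> {..<v + w}" "computes C h"
    and Q: "is_face Q (NPT g)"
    and f: "vars f \<subseteq> {..<v'}" "f = mpoly_subst \<sigma> (mpoly_restrict g Q)"
    and \<sigma>: "\<And>i. affine_linear (\<sigma> i)"
  defines "k \<equiv> 2 * ((v + 1) * ((v + 1) * (total_degree g + 1) + 7))"
  obtains H C' where "vars H \<subseteq> {..<v' + (w + k)}" "f = hypercube_sum v' (w + k) H"
    "total_degree H \<le> k + total_degree h * (k + 1)"
    "computes C' H" "length C' \<le> (v + w) * (4 * v' + 6 * k + 5) + length C + 6 * k + 5"
proof -
  obtain a b :: "nat \<Rightarrow> 'a" and \<theta> :: "nat \<Rightarrow> nat \<Rightarrow> 'a" where ab: "\<And>m. m \<in> Poly_Mapping.keys g \<Longrightarrow>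
      (\<Prod>i<k. a i + b i * (\<Prod>l<v. \<theta> i l ^ Poly_Mapping.lookup m l)) = (if exponent_point m \<in> Q then 1 else 0)"
    unfolding k_def by (rule face_multipliers[OF Q g(1)]) blast
  \<comment> \<open>\<open>f\<close> has no variables from \<open>v'\<close> on, so setting them to
    0 preserves \<open>f\<close> while shortening each \<open>\<sigma> i\<close> to at most
    \<open>v'\<close> variables.\<close>
  define \<rho> where "\<rho> = (\<lambda>j. if j < v' then Var j else 0 :: 'a mpoly)"
  define \<sigma>' where "\<sigma>' i = mpoly_subst \<rho> (\<sigma> i)" for i
  have "\<exists>c A. \<sigma>' i = Const c + (\<Sum>j<v'. Const (A j) * Var j)" for i
    using affine_linear_truncate[OF \<sigma>[of i], of v'] unfolding \<sigma>'_def \<rho>_def by metis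
  then obtain c A where \<sigma>': "\<And>i. \<sigma>' i = Const (c i) + (\<Sum>j<v'. Const (A i j) * Var j)" by metis
  have vars_\<sigma>': "vars (\<sigma>' i) \<subseteq> {..<v'}" for i
    unfolding \<sigma>' by (intro vars_add_subset vars_sum_subset vars_mult_subset) auto
  have "f = mpoly_subst Var f" by (simp add: mpoly_subst_Var_id)
  also have "\<dots> = mpoly_subst \<rho> f"
    using f(1) by (intro mpoly_subst_cong) (auto simp: \<rho>_def)
  also have "\<dots> = mpoly_subst \<sigma>' (mpoly_restrict g Q)"
    unfolding f(2) mpoly_subst_mpoly_subst \<sigma>'_def ..
  finally have f': "f = mpoly_subst \<sigma>' (mpoly_restrict g Q)" .

  \<comment> \<open>The original hypercube variables move from \<open>v\<close> to
    \<open>v'\<close>. The default 0 keeps the set of values finite, since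
    \<open>derives_mpoly_subst\<close> wants every \<open>\<tau> l\<close> available.\<close>
  define \<tau> where "\<tau> l = (if l < v then \<sigma>' l * (\<Prod>i<k. 1 + Const (\<theta> i l - 1) * Var (v' + w + i))
    else if l < v + w then Var (v' + (l - v)) else 0)" for l
  \<comment> \<open>The weights of the rescaled copies: on a 0/1 point, each factor is
    \<open>a i\<close> or \<open>b i\<close>.\<close>
  define P where "P = (\<Prod>i<k. Const (a i) + Const (b i - a i) * Var (v' + w + i))"
  define H where "H = P * mpoly_subst \<tau> h"

  have vars_H: "vars H \<subseteq> {..<v' + (w + k)}"
  proof -
    have "vars (\<sigma>' l) \<subseteq> {..<v' + (w + k)}" for l using vars_\<sigma>'[of l] by auto
    then have "vars (\<sigma>' l * (\<Prod>i<k. 1 + Const (\<theta> i l - 1) * Var (v' + w + i))) \<subseteq> {..<v' + (w + k)}" for l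
      by (intro vars_mult_subset vars_prod_subset vars_add_subset) auto
    then have "vars (\<tau> l) \<subseteq> {..<v' + (w + k)}" for l
      by (auto simp: \<tau>_def subset_iff)
    then show ?thesis
      unfolding H_def P_def
      by (intro vars_mult_subset vars_mpoly_subst_subset vars_prod_subset vars_add_subset) auto
  qed

  have deg_H: "total_degree H \<le> k + total_degree h * (k + 1)"
  proof -
    have cv: "total_degree (Const x * Var j :: 'a mpoly) \<le> 1" for x j
      using total_degree_mult[of "Const x" 0 "Var j :: 'a mpoly" 1] by simp
    have \<sigma>1: "total_degree (\<sigma>' l) \<le> 1" for l
      unfolding \<sigma>' using cv by (intro total_degree_add total_degree_sum) auto
    have \<Pi>: "total_degree (\<Prod>i<k. Const (x i) + Const (y i) * Var (v' + w + i) :: 'a mpoly) \<le> k" for x y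
    proof -
      have "total_degree (Const (x i) + Const (y i) * Var (v' + w + i) :: 'a mpoly) \<le> 1" for i
        using cv by (intro total_degree_add) auto
      from total_degree_prod[OF this, of "\<lambda>i. i" "{..<k}"] show ?thesis
        by simp
    qed
    have "total_degree (\<tau> l) \<le> k + 1" for l
      using total_degree_mult[OF \<sigma>1[of l] \<Pi>[of "\<lambda>_. 1" "\<lambda>i. \<theta> i l - 1"]] by (simp add: \<tau>_def)
    then show ?thesis
      unfolding H_def P_def by (intro total_degree_mult \<Pi> total_degree_mpoly_subst)
  qed

  \<comment> \<open>The summands: \<open>P\<close>, all \<open>\<tau> l\<close> below
    \<open>v + w\<close>, the default 0, a replay of \<open>C\<close>, the final product, and 2 for
    placing the output last.\<close>
  have "\<exists>C'. computes C' H \<and> length C' \<le> (6 * k + 1 + ((v + w) * (4 * v' + 6 * k + 5) + 1 + length C) + 1) + 2"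
  proof (rule derives_computes)
    have cv: "derives {} 3 {Const x * Var j :: 'a mpoly}" for x j
      using derives_mult[OF derives_Const derives_Var, of "{}" x j] by (simp add: numeral_3_eq_3)
    have \<sigma>s: "derives {} (4 * v' + 3) {\<sigma>' l}" for l
      by (rule derives_mono[OF derives_add[OF derives_Const derives_sum[OF cv]]]) (auto simp: \<sigma>')
    have \<Pi>: "derives {} (6 * k + 1) {\<Prod>i<k. Const (x i) + Const (y i) * Var (v' + w + i) :: 'a mpoly}" for x y
      by (rule derives_mono[OF derives_prod[OF derives_add[OF derives_Const cv]]]) auto
    have "derives {} (4 * v' + 6 * k + 5) {\<tau> l}" if "l < v + w" for l
    proof (cases "l < v")
      case True
      then show ?thesis
        by (intro derives_mono[OF derives_mult[OF \<sigma>s[of l] \<Pi>[of "\<lambda>_. 1" "\<lambda>i. \<theta> i l - 1"]]])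
          (auto simp: \<tau>_def)
    next
      case False
      with that show ?thesis
        by (intro derives_mono[OF derives_Var[of "{}" "v' + (l - v)"]]) (auto simp: \<tau>_def)
    qed
    then have "derives {} ((v + w) * (4 * v' + 6 * k + 5)) (\<tau> ` {..<v + w})"
      by (intro derives_image) auto
    from derives_Un[OF this derives_Const[of _ 0]]
    have "derives {} ((v + w) * (4 * v' + 6 * k + 5) + 1) (\<tau> ` {..<v + w} \<union> {0})" by simp
    from derives_trans'[OF this derives_mpoly_subst[OF h(2), of \<tau>]]
    have "derives {} ((v + w) * (4 * v' + 6 * k + 5) + 1 + length C) {mpoly_subst \<tau> h}"
      by (auto simp: \<tau>_def)
    then show "derives {} (6 * k + 1 + ((v + w) * (4 * v' + 6 * k + 5) + 1 + length C) + 1) {H}"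
      unfolding H_def P_def by (intro derives_mult \<Pi>)
  qed
  then obtain C' where C': "computes C' H"
    "length C' \<le> (v + w) * (4 * v' + 6 * k + 5) + length C + 6 * k + 5"
    by auto

  define \<alpha> where "\<alpha> e = (\<Prod>i<k. a i + (b i - a i) * e i)" for e :: "nat \<Rightarrow> 'a"
  define \<Theta> where "\<Theta> e l = (\<Prod>i<k. 1 + (\<theta> i l - 1) * e i)" for e :: "nat \<Rightarrow> 'a" and l
  define S where "S n e = (\<lambda>i. if i < n then Var i else Const (e (i - n)) :: 'a mpoly)" for n e
  \<comment> \<open>\<open>e1\<close> is the point of the hypercube already summed over for
    \<open>g\<close>, \<open>e2\<close> the one selecting the rescaling.\<close>
  define G where "G e1 e2 = Const (\<alpha> e2) * mpoly_subst (\<lambda>l. Const (\<Theta> e2 l) * \<sigma>' l) (mpoly_subst (S v e1) h)"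
    for e1 e2
  have subst_H: "mpoly_subst (S v' e) H = G (restrict e {..<w}) (\<lambda>i\<in>{..<k}. e (w + i))" for e
  proof -
    let ?e1 = "restrict e {..<w}" and ?e2 = "\<lambda>i\<in>{..<k}. e (w + i)"
    have S_y: "S v' e (v' + w + i) = Const (e (w + i))" for i
      by (simp add: S_def add.assoc)
    have "mpoly_subst (S v' e) P = Const (\<alpha> ?e2)"
      by (simp add: P_def \<alpha>_def mpoly_subst_prod mpoly_subst_add mpoly_subst_mult S_y
          Const_prod Const_add Const_mult)
    moreover have "mpoly_subst (S v' e) (\<tau> l) = mpoly_subst (\<lambda>l. Const (\<Theta> ?e2 l) * \<sigma>' l) (S v ?e1 l)"
      if "l < v + w" for l
    proof (cases "l < v")
      case True
      have "mpoly_subst (S v' e) (\<sigma>' l) = mpoly_subst Var (\<sigma>' l)"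
        using vars_\<sigma>'[of l] by (intro mpoly_subst_cong) (auto simp: S_def)
      with True show ?thesis
        by (simp add: \<tau>_def \<Theta>_def S_y S_def[of v] mpoly_subst_mult mpoly_subst_prod mpoly_subst_add
            mpoly_subst_Var_id Const_prod Const_add Const_mult mult.commute)
    next
      case False
      with that show ?thesis by (auto simp: \<tau>_def S_def)
    qed
    then have "mpoly_subst (S v' e) (mpoly_subst \<tau> h)
        = mpoly_subst (\<lambda>l. Const (\<Theta> ?e2 l) * \<sigma>' l) (mpoly_subst (S v ?e1) h)"
      unfolding mpoly_subst_mpoly_subst using h(1) by (intro mpoly_subst_cong) auto
    ultimately show ?thesis
      by (simp add: H_def G_def mpoly_subst_mult)
  qed
  have "hypercube_sum v' (w + k) H = (\<Sum>e\<in>PiE {..<w + k} (\<lambda>_. {0, 1}). mpoly_subst (S v' e) H)"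
    by (simp add: hypercube_sum_def S_def)
  also have "\<dots> = (\<Sum>e1\<in>PiE {..<w} (\<lambda>_. {0, 1}). \<Sum>e2\<in>PiE {..<k} (\<lambda>_. {0, 1}). G e1 e2)"
    unfolding subst_H by (rule sum_PiE_lessThan_add)
  \<comment> \<open>Now the inner sum over \<open>e1\<close> runs over copies of \<open>h\<close>
    under one fixed scaling and gives back \<open>g\<close>.\<close>
  also have "\<dots> = (\<Sum>e2\<in>PiE {..<k} (\<lambda>_. {0, 1}). \<Sum>e1\<in>PiE {..<w} (\<lambda>_. {0, 1}). G e1 e2)"
    by (rule sum.swap)
  also have "\<dots> = (\<Sum>e2\<in>PiE {..<k} (\<lambda>_. {0, 1}). Const (\<alpha> e2) * mpoly_subst (\<lambda>l. Const (\<Theta> e2 l) * \<sigma>' l) g)"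
    unfolding G_def g(2) by (simp add: hypercube_sum_def S_def mpoly_subst_sum sum_distrib_left)
  also have "\<dots> = f"
    unfolding f' \<alpha>_def \<Theta>_def by (rule mpoly_subst_restrict_eq_hypercube_sum[OF g(1) ab, symmetric])
  finally show ?thesis using that[OF vars_H _ deg_H C'] by simp
qed

section \<open>From single polynomials to families\<close>

theorem theorem4p2:
  shows "(Newton_VNP :: 'a::alg_closed_field family set) \<subseteq> VNP"
proof
  fix f :: "'a family" assume "f \<in> Newton_VNP"
  then obtain g where fv: "poly_many_vars f" and g: "g \<in> VNP"
    and fg: "\<And>n. \<exists>Q. is_face Q (NPT (g n)) \<and>
        (f n = mpoly_restrict (g n) Q \<or> linear_projection (f n) (mpoly_restrict (g n) Q))"
    unfolding Newton_VNP_def by auto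
  \<comment> \<open>A bare restriction is its own projection under the identity substitution
    \<open>Var\<close>, so both cases of the definition become one.\<close>
  have "\<exists>Q \<sigma>. is_face Q (NPT (g n)) \<and> (\<forall>i. affine_linear (\<sigma> i)) \<and>
      f n = mpoly_subst \<sigma> (mpoly_restrict (g n) Q)" for n
    using fg[of n] unfolding linear_projection_def
    by (metis affine_linear_Var mpoly_subst_Var_id)
  then obtain Q \<sigma> where Q: "\<And>n. is_face (Q n) (NPT (g n))" and \<sigma>: "\<And>n i. affine_linear (\<sigma> n i)"
    and f: "\<And>n. f n = mpoly_subst (\<sigma> n) (mpoly_restrict (g n) (Q n))"
    by metis
  obtain v' where v': "poly_bounded v'" "\<And>n. vars (f n) \<subseteq> {..<v' n}"
    using fv unfolding poly_many_vars_def by blast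
  obtain h v w where h: "h \<in> VP" and vw: "poly_bounded v" "poly_bounded w"
    and gh: "\<And>n. vars (g n) \<subseteq> {..<v n}" "\<And>n. vars (h n) \<subseteq> {..<v n + w n}"
      "\<And>n. g n = hypercube_sum (v n) (w n) (h n)"
    and deg_g: "poly_bounded (\<lambda>n. total_degree (g n))"
    using g unfolding VNP_def by blast
  obtain s C where deg_h: "poly_bounded (\<lambda>n. total_degree (h n))" and s: "poly_bounded s"
    and C: "\<And>n. computes (C n) (h n)" "\<And>n. length (C n) \<le> s n"
    using h unfolding VP_def by (auto simp: choice_iff)
  define k where "k n = 2 * ((v n + 1) * ((v n + 1) * (total_degree (g n) + 1) + 7))" for n
  have k: "poly_bounded k"
    unfolding k_def by (intro poly_bounded_intros vw deg_g)
  have "\<exists>H C'. vars H \<subseteq> {..<v' n + (w n + k n)} \<and> f n = hypercube_sum (v' n) (w n + k n) H \<and>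
      total_degree H \<le> k n + total_degree (h n) * (k n + 1) \<and> computes C' H \<and>
      length C' \<le> (v n + w n) * (4 * v' n + 6 * k n + 5) + length (C n) + 6 * k n + 5" for n
    unfolding k_def
    by (rule hypercube_sum_witness[OF gh(1) gh(3) gh(2) C(1) Q v'(2) f \<sigma>]) blast
  then obtain H C' where H: "\<And>n. vars (H n) \<subseteq> {..<v' n + (w n + k n)}"
      "\<And>n. f n = hypercube_sum (v' n) (w n + k n) (H n)"
      "\<And>n. total_degree (H n) \<le> k n + total_degree (h n) * (k n + 1)"
    and C': "\<And>n. computes (C' n) (H n)"
      "\<And>n. length (C' n) \<le> (v n + w n) * (4 * v' n + 6 * k n + 5) + length (C n) + 6 * k n + 5"
    by metis
  have "H \<in> VP"
    unfolding VP_def mem_Collect_eq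
  proof (intro conjI)
    show "poly_many_vars H"
      unfolding poly_many_vars_def using H(1) v'(1) vw(2) k by (blast intro: poly_bounded_add)
    show "poly_bounded (\<lambda>n. total_degree (H n))"
      by (rule poly_bounded_mono[OF _ H(3)]) (intro poly_bounded_intros k deg_h)
    have "length (C' n) \<le> (v n + w n) * (4 * v' n + 6 * k n + 5) + s n + 6 * k n + 5" for n
      using C'(2)[of n] C(2)[of n] by linarith
    moreover have "poly_bounded (\<lambda>n. (v n + w n) * (4 * v' n + 6 * k n + 5) + s n + 6 * k n + 5)"
      by (intro poly_bounded_intros vw v' k s)
    ultimately show "\<exists>s. poly_bounded s \<and> (\<forall>n. \<exists>C. computes C (H n) \<and> length C \<le> s n)"
      using C'(1) by blast
  qed
  \<comment> \<open>Restriction keeps a subset of the monomials, and affine forms have degree at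
    most 1.\<close>
  moreover have "total_degree (f n) \<le> total_degree (g n)" for n
  proof -
    have "total_degree (f n) \<le> total_degree (mpoly_restrict (g n) (Q n)) * 1"
      unfolding f using \<sigma> by (intro total_degree_mpoly_subst total_degree_affine_linear)
    with total_degree_mpoly_restrict[of "g n" "Q n"] show ?thesis by simp
  qed
  then have "poly_bounded (\<lambda>n. total_degree (f n))"
    by (rule poly_bounded_mono[OF deg_g])
  moreover have "poly_bounded (\<lambda>n. w n + k n)" using vw k by (intro poly_bounded_add)
  ultimately show "f \<in> VNP"
    unfolding VNP_def mem_Collect_eq using fv v' H(1,2)
    by (intro conjI bexI[of _ H] exI[of _ v'] exI[of _ "\<lambda>n. w n + k n"] allI)
qed

end
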